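(* Let $(X,\mathcal{M},\mu)$ be a measure space with $\mu(X)<\infty$, and $\Phi$ an $N^*$-function for which there is a constant $k\ge2$ with $\Phi(kx)=2\Phi(x)$ for all $x>0$. If $\Lambda=\emptyset$, every continuous linear functional on $(L_\Phi(X),\|\cdot\|_\Phi)$ is identically zero. If $\Lambda\ne\emptyset$, let $\{A_i\}$ be a finite or countable family of pairwise disjoint atoms such that every atom coincides up to a $\mu$-null set with exactly one $A_i$, put $a_i=\mu(A_i)$, and for measurable $f$ let $\overline f_i$ be the a.e. constant value of $f$ on $A_i$. Then every continuous linear functional $U$ on $L_\Phi(X)$ has the form $U(f)=\sum_i u_i\overline f_i$ (with $u_i=U(\chi_{A_i})$), and $\|U\|=\sup_i|u_i|\,\Phi^{-1}(1/a_i)$. Conversely, if real numbers $u_i$ satisfy $|u_i|\le K/\Phi^{-1}(1/a_i)$ for all $i$, for some constant $K$, then $f\mapsto\sum_iu_i\overline f_i$ is a continuous linear functional on $L_\Phi(X)$.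
   Context: An $N^*$-function is a function $\Phi:\mathbb{R}\to\mathbb{R}$ of the form $\Phi(x)=\int_0^{|x|}p(t)\,dt<+\infty$ for all $x$, where $p:[0,\infty)\to[0,\infty]$ is right-continuous, positive on $(0,\infty)$, non-increasing, and satisfies $\lim_{t\to0^+}p(t)=+\infty$ and $\lim_{t\to+\infty}p(t)=0$. $\Phi^{-1}$ is the inverse of $\Phi|_{[0,\infty)}$. $L_\Phi(X)$ is the space of (classes modulo a.e. equality of) measurable $f$ with $\int_X\Phi(f)\,d\mu<\infty$, with quasi-norm $\|f\|_\Phi=\inf\{\lambda>0:\int_X\Phi(|f|/\lambda)\,d\mu\le1\}$; for a linear functional $U$, $\|U\|=\sup\{|U(f)|:\|f\|_\Phi\le1\}$. An atom is a set $A\in\mathcal{M}$ with $\mu(A)>0$ such that every measurable $B\subset A$ with $\mu(B)<\mu(A)$ has $\mu(B)=0$; $\Lambda$ denotes the collection of atoms. *)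

theory Defs
  imports "HOL-Analysis.Analysis"
begin

definition N_star_function :: "(real \<Rightarrow> real) \<Rightarrow> bool" where
  "N_star_function \<Phi> \<longleftrightarrow> (\<exists>p :: real \<Rightarrow> ennreal.
     (\<forall>t>0. p t > 0) \<and>
     (\<forall>s t. 0 \<le> s \<longrightarrow> s \<le> t \<longrightarrow> p t \<le> p s) \<and>
     (\<forall>t\<ge>0. continuous (at_right t) p) \<and>
     (p \<longlongrightarrow> \<infinity>) (at_right 0) \<and>
     (p \<longlongrightarrow> 0) at_top \<and>
     (\<forall>x. set_nn_integral lborel {0..\<bar>x\<bar>} p < \<infinity> \<and>
          \<Phi> x = enn2real (set_nn_integral lborel {0..\<bar>x\<bar>} p)))"

definition Phi_inv :: "(real \<Rightarrow> real) \<Rightarrow> real \<Rightarrow> real" where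
  "Phi_inv \<Phi> y = (THE x. 0 \<le> x \<and> \<Phi> x = y)"

text \<open>Orlicz-type space L_Phi (representatives; classes modulo a.e. equality are handled by
  requiring functionals to respect a.e. equality).\<close>
definition L_Phi :: "'a measure \<Rightarrow> (real \<Rightarrow> real) \<Rightarrow> ('a \<Rightarrow> real) set" where
  "L_Phi M \<Phi> = {f \<in> borel_measurable M. (\<integral>\<^sup>+ x. ennreal (\<Phi> (f x)) \<partial>M) < \<infinity>}"

definition Phi_norm :: "'a measure \<Rightarrow> (real \<Rightarrow> real) \<Rightarrow> ('a \<Rightarrow> real) \<Rightarrow> real" where
  "Phi_norm M \<Phi> f = Inf {l::real. l > 0 \<and> (\<integral>\<^sup>+ x. ennreal (\<Phi> (\<bar>f x\<bar> / l)) \<partial>M) \<le> 1}"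

definition cont_lin_functional ::
  "'a measure \<Rightarrow> (real \<Rightarrow> real) \<Rightarrow> (('a \<Rightarrow> real) \<Rightarrow> real) \<Rightarrow> bool" where
  "cont_lin_functional M \<Phi> U \<longleftrightarrow>
     (\<forall>f\<in>L_Phi M \<Phi>. \<forall>g\<in>L_Phi M \<Phi>. U (\<lambda>x. f x + g x) = U f + U g) \<and>
     (\<forall>f\<in>L_Phi M \<Phi>. \<forall>c::real. U (\<lambda>x. c * f x) = c * U f) \<and>
     (\<forall>f\<in>L_Phi M \<Phi>. \<forall>g\<in>L_Phi M \<Phi>. (AE x in M. f x = g x) \<longrightarrow> U f = U g) \<and>
     (\<forall>f\<in>L_Phi M \<Phi>. \<forall>\<epsilon>>0. \<exists>\<delta>>0. \<forall>g\<in>L_Phi M \<Phi>.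
        Phi_norm M \<Phi> (\<lambda>x. g x - f x) < \<delta> \<longrightarrow> \<bar>U g - U f\<bar> < \<epsilon>)"

definition functional_norm ::
  "'a measure \<Rightarrow> (real \<Rightarrow> real) \<Rightarrow> (('a \<Rightarrow> real) \<Rightarrow> real) \<Rightarrow> ereal" where
  "functional_norm M \<Phi> U =
     Sup ((\<lambda>f. ereal \<bar>U f\<bar>) ` {f \<in> L_Phi M \<Phi>. Phi_norm M \<Phi> f \<le> 1})"

definition is_atom :: "'a measure \<Rightarrow> 'a set \<Rightarrow> bool" where
  "is_atom M A \<longleftrightarrow> A \<in> sets M \<and> emeasure M A > 0 \<and>
     (\<forall>B\<in>sets M. B \<subseteq> A \<longrightarrow> emeasure M B < emeasure M A \<longrightarrow> emeasure M B = 0)"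

definition atom_family :: "'a measure \<Rightarrow> nat set \<Rightarrow> (nat \<Rightarrow> 'a set) \<Rightarrow> bool" where
  "atom_family M I A \<longleftrightarrow> disjoint_family_on A I \<and> (\<forall>i\<in>I. is_atom M (A i)) \<and>
     (\<forall>B. is_atom M B \<longrightarrow> (\<exists>!i. i \<in> I \<and> emeasure M ((B - A i) \<union> (A i - B)) = 0))"

definition fbar :: "'a measure \<Rightarrow> 'a set \<Rightarrow> ('a \<Rightarrow> real) \<Rightarrow> real" where
  "fbar M A f = (THE c. AE x in M. x \<in> A \<longrightarrow> f x = c)"

end

(* Continuity of a functional U at 0 means that U (f) is small when the modular, the integral of Phi (f),
   is small. Since the slope of Phi tends to 0, the scaling constant satisfies k > 2. On an atomless part
   U vanishes: halving the modular of f repeatedly and keeping the half on which |U| is larger yields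
   after m steps a piece g with |U (2^m g)| >= |U (f)|; if 2^m <= k^j < 2^(m+1), the modular of 2^m g is
   at most 2 (2/k)^j times that of f, hence tends to 0. So U is determined by its values on the atoms
   A_i, and the norm formula follows from the concavity estimate
   |f_i| / Phi_inv (1 / a_i) <= a_i Phi (f_i), valid for modular at most 1, because the right-hand sides
   sum to at most the modular. *)
theory Submission
  imports Defs
begin

section \<open>N-star functions\<close>

text \<open>The model case is \<Phi>(x) = |x|^q with 0 < q < 1 and k = 2^(1/q), where the atomless
  half is Day's theorem on L^q. The modular takes the place of the quasi-norm because it is additive
  over disjoint pieces of f and because multiplication by k^n changes it by exactly the factor 2^n.
  The additivity also dictates where the bisection happens: not in the given measure, but in the
  measure that sends S to the modular of f on S, with density \<Phi>(f). This calls for two facts: a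
  density creates no atoms, and a finite atomless measure attains every intermediate value.
  Strictness of 2 < k is the whole gain; at k = 2, as for |x| and L^1, halving and rescaling would
  cancel.\<close>

lemma antimono_borel_measurable_ennreal:
  fixes q :: "real \<Rightarrow> ennreal"
  assumes "antimono q"
  shows "q \<in> borel_measurable borel"
proof (rule borel_measurableI_less)
  fix y
  have "is_interval {x. q x < y}"
    unfolding is_interval_1
    using antimonoD[OF assms] by (auto intro: le_less_trans)
  then show "{x \<in> space borel. q x < y} \<in> sets borel"
    using real_interval_borel_measurable by simp
qed

lemma N_star_function_integral:
  assumes "N_star_function \<Phi>"
  shows "\<exists>p :: real \<Rightarrow> ennreal. \<forall>x. \<Phi> x = enn2real (set_nn_integral lborel {0..\<bar>x\<bar>} p)"
  using assms unfolding N_star_function_def by (rule ex_forward) (unfold all_conj_distrib, elim conjE, assumption)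

lemma N_star_function_abs:
  assumes "N_star_function \<Phi>"
  shows "\<Phi> \<bar>x\<bar> = \<Phi> x"
proof -
  obtain p where "\<And>x. \<Phi> x = enn2real (set_nn_integral lborel {0..\<bar>x\<bar>} p)"
    using N_star_function_integral[OF assms] by auto
  from this[of x] this[of "\<bar>x\<bar>"] show ?thesis by simp
qed

lemma N_star_function_0:
  assumes "N_star_function \<Phi>"
  shows "\<Phi> 0 = 0"
proof -
  have *: "set_nn_integral lborel {0..\<bar>0\<bar>} p = 0" for p :: "real \<Rightarrow> ennreal"
  proof -
    \<comment> \<open>The density may be infinite at 0, so its value there is discarded through the
      null set {0}.\<close>
    have "AE x in lborel. x \<noteq> (0::real)" by (rule AE_lborel_singleton)
    then have "AE x in lborel. p x * indicator {0..\<bar>0\<bar>} x = 0"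
      by eventually_elim (auto simp: indicator_def)
    then show ?thesis by (subst nn_integral_cong_AE[where v = "\<lambda>_. 0"]) auto
  qed
  obtain p where "\<And>x. \<Phi> x = enn2real (set_nn_integral lborel {0..\<bar>x\<bar>} p)"
    using N_star_function_integral[OF assms] by auto
  from this[of 0] * show ?thesis by simp
qed

text \<open>The density is non-increasing, so the secant of \<Phi> from x to y has slope between its
  values at y and at x; all three claims are read off from this, hence the joint proof. Concavity is
  recorded only as monotonicity of \<Phi>(x)/x, cleared of denominators so that 0 is
  covered.\<close>

lemma
  assumes "N_star_function \<Phi>"
  shows N_star_function_strict_mono: "\<And>x y. 0 \<le> x \<Longrightarrow> x < y \<Longrightarrow> \<Phi> x < \<Phi> y"
    and N_star_function_concave: "\<And>y z. 0 \<le> y \<Longrightarrow> y \<le> z \<Longrightarrow> y * \<Phi> z \<le> z * \<Phi> y"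
    and N_star_function_vanishing_slope:
      "\<And>e. 0 < e \<Longrightarrow> \<exists>T>0. \<forall>x y. T \<le> x \<longrightarrow> x < y \<longrightarrow> \<Phi> y - \<Phi> x \<le> e * (y - x)"
proof -
  obtain P :: "real \<Rightarrow> ennreal" where P:
    "\<forall>t>0. P t > 0" "\<And>s t. 0 \<le> s \<Longrightarrow> s \<le> t \<Longrightarrow> P t \<le> P s"
    "(P \<longlongrightarrow> 0) at_top"
    "\<And>x. set_nn_integral lborel {0..\<bar>x\<bar>} P < \<infinity>"
    "\<And>x. \<Phi> x = enn2real (set_nn_integral lborel {0..\<bar>x\<bar>} P)"
    using assms unfolding N_star_function_def by blast
  \<comment> \<open>Nothing is known about \<open>P\<close> at negative arguments. Setting it to
    infinity there makes the function antitone on the whole line, hence Borel, and does not affect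
    integrals over {0..x}.\<close>
  define Q where "Q t = (if t < 0 then \<infinity> else P t)" for t
  have "antimono Q"
    unfolding antimono_def Q_def using P(2) by auto
  then have Q [measurable]: "Q \<in> borel_measurable borel"
    by (rule antimono_borel_measurable_ennreal)
  define I where "I x = set_nn_integral lborel {0..x} Q" for x :: real
  have IP: "I x = set_nn_integral lborel {0..x} P" for x
    unfolding I_def by (intro nn_integral_cong) (auto simp: Q_def indicator_def)
  have I_fin: "I x < \<infinity>" if "0 \<le> x" for x
    using P(4)[of x] that unfolding IP by simp
  have Phi: "\<Phi> x = enn2real (I x)" if "0 \<le> x" for x
    using P(5)[of x] that unfolding IP by simp
  have split: "I y = I x + set_nn_integral lborel {x<..y} Q" if "0 \<le> x" "x < y" for x y
  proof -
    have "I y = set_nn_integral lborel ({0..x} \<union> {x<..y}) Q"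
      unfolding I_def using that by (simp add: ivl_disj_un_two)
    also have "\<dots> = I x + set_nn_integral lborel {x<..y} Q"
      unfolding I_def by (rule nn_integral_disjoint_pair) auto
    finally show ?thesis .
  qed
  have lower: "ennreal (y - x) * P y \<le> set_nn_integral lborel {x<..y} Q" if "0 \<le> x" "x < y" for x y
  proof -
    have "ennreal (y - x) * P y = set_nn_integral lborel {x<..y} (\<lambda>_. P y)"
      using that by (simp add: nn_integral_cmult_indicator mult.commute)
    also have "\<dots> \<le> set_nn_integral lborel {x<..y} Q"
      using that by (intro nn_integral_mono) (auto simp: Q_def indicator_def intro!: P(2))
    finally show ?thesis .
  qed
  have upper: "set_nn_integral lborel {x<..y} Q \<le> ennreal (y - x) * P x" if "0 \<le> x" "x < y" for x y
  proof -
    have "set_nn_integral lborel {x<..y} Q \<le> set_nn_integral lborel {x<..y} (\<lambda>_. P x)"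
      using that by (intro nn_integral_mono) (auto simp: Q_def indicator_def intro!: P(2))
    also have "\<dots> = ennreal (y - x) * P x"
      using that by (simp add: nn_integral_cmult_indicator mult.commute)
    finally show ?thesis .
  qed
  \<comment> \<open>An infinite value at t > 0 would be infinite on all of (0, t] as well and make
    the integral up to t infinite. From here on real arithmetic is possible, except at 0.\<close>
  have P_fin: "P t < \<infinity>" if "t > 0" for t
  proof (rule ccontr)
    assume "\<not> P t < \<infinity>"
    then have "P t = \<infinity>" by (simp add: less_top[symmetric])
    then have "ennreal t * P t = \<infinity>"
      using that by (simp add: ennreal_mult_top)
    moreover have "ennreal t * P t \<le> I t"
      using lower[of 0 t] split[of 0 t] that by (auto intro: order_trans add_increasing)
    ultimately show False using I_fin[of t] that by (simp add: top_unique)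
  qed
  define p where "p t = enn2real (P t)" for t
  have Pp: "P t = ennreal (p t)" if "t > 0" for t
    using P_fin[OF that] unfolding p_def by simp
  have inc: "ennreal (\<Phi> y - \<Phi> x) = set_nn_integral lborel {x<..y} Q"
    and mono: "\<Phi> x \<le> \<Phi> y" if "0 \<le> x" "x < y" for x y
  proof -
    have *: "ennreal (\<Phi> y) = ennreal (\<Phi> x) + set_nn_integral lborel {x<..y} Q"
      using split[OF that] I_fin[of x] I_fin[of y] that by (simp add: Phi)
    then have "ennreal (\<Phi> x) \<le> ennreal (\<Phi> y)"
      by simp
    then show "\<Phi> x \<le> \<Phi> y" using that by (simp add: Phi)
    show "ennreal (\<Phi> y - \<Phi> x) = set_nn_integral lborel {x<..y} Q"
      using * that by (simp add: ennreal_minus[symmetric] Phi)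
  qed
  have p_nonneg: "0 \<le> p t" for t
    by (simp add: p_def)
  have pos: "p t > 0" if "t > 0" for t
    using P(1) P_fin[OF that] that unfolding p_def by (simp add: enn2real_positive_iff)
  have lim: "(p \<longlongrightarrow> 0) at_top"
    using tendsto_enn2real[of P 0 at_top] P(3) unfolding p_def by simp
  have le1: "(y - x) * p y \<le> \<Phi> y - \<Phi> x" if "0 \<le> x" "x < y" for x y
  proof -
    have "ennreal ((y - x) * p y) \<le> ennreal (\<Phi> y - \<Phi> x)"
      using lower[OF that] that by (simp add: inc Pp ennreal_mult p_nonneg)
    then show ?thesis using mono[OF that] by simp
  qed
  have le2: "\<Phi> y - \<Phi> x \<le> (y - x) * p x" if "0 < x" "x < y" for x y
  proof -
    have "ennreal (\<Phi> y - \<Phi> x) \<le> ennreal ((y - x) * p x)"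
      using upper[of x y] that by (simp add: inc Pp ennreal_mult p_nonneg)
    then show ?thesis using that by (subst (asm) ennreal_le_iff) (auto simp: p_nonneg)
  qed
  show "\<Phi> x < \<Phi> y" if "0 \<le> x" "x < y" for x y
    using le1[OF that] mult_pos_pos[of "y - x" "p y"] pos[of y] that by linarith
  show "y * \<Phi> z \<le> z * \<Phi> y" if "0 \<le> y" "y \<le> z" for y z
  proof (cases "0 < y \<and> y < z")
    case True
    \<comment> \<open>The number \<open>p y\<close> separates the two secants: the slope on [y, z]
      is at most \<open>p y\<close>, the slope on [0, y] at least \<open>p y\<close>. The case y = 0
      is set apart because the density may be infinite there.\<close>
    have "y * (\<Phi> z - \<Phi> y) \<le> y * ((z - y) * p y)"
      using le2[of y z] True by (intro mult_left_mono) auto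
    also have "\<dots> = (z - y) * (y * p y)" by simp
    also have "\<dots> \<le> (z - y) * \<Phi> y"
      using le1[of 0 y] N_star_function_0[OF assms] True by (intro mult_left_mono) auto
    finally show ?thesis by (simp add: algebra_simps)
  next
    case False
    then show ?thesis using that N_star_function_0[OF assms] by (cases "y = 0") auto
  qed
  show "\<exists>T>0. \<forall>x y. T \<le> x \<longrightarrow> x < y \<longrightarrow> \<Phi> y - \<Phi> x \<le> e * (y - x)" if "0 < e" for e
  proof -
    from order_tendstoD(2)[OF lim that] obtain T where T: "\<And>t. T \<le> t \<Longrightarrow> p t < e"
      unfolding eventually_at_top_linorder by blast
    \<comment> \<open>The maximum with 1 keeps x positive, as \<open>le2\<close> demands; the
      threshold from the limit could be negative.\<close>
    have "\<Phi> y - \<Phi> x \<le> e * (y - x)" if "max T 1 \<le> x" "x < y" for x y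
    proof -
      have "(y - x) * p x \<le> (y - x) * e"
        using T[of x] that by (intro mult_left_mono) auto
      moreover have "\<Phi> y - \<Phi> x \<le> (y - x) * p x"
        using le2[of x y] that by simp
      ultimately show ?thesis by (simp add: mult.commute)
    qed
    then show ?thesis by (intro exI[of _ "max T 1"]) auto
  qed
qed

section \<open>Subadditivity, scaling, continuity and inversion of \<Phi>\<close>

locale N_star_doubling =
  fixes \<Phi> :: "real \<Rightarrow> real" and k :: real
  assumes N: "N_star_function \<Phi>"
    and k_ge_2: "2 \<le> k"
    and Phi_doubling: "\<And>x. 0 < x \<Longrightarrow> \<Phi> (k * x) = 2 * \<Phi> x"
begin

lemma Phi_abs [simp]: "\<Phi> \<bar>x\<bar> = \<Phi> x"
  by (rule N_star_function_abs[OF N])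

lemma Phi_0 [simp]: "\<Phi> 0 = 0"
  by (rule N_star_function_0[OF N])

lemmas Phi_strict_mono = N_star_function_strict_mono[OF N]
lemmas Phi_concave = N_star_function_concave[OF N]

lemma Phi_mono: "0 \<le> x \<Longrightarrow> x \<le> y \<Longrightarrow> \<Phi> x \<le> \<Phi> y"
  using Phi_strict_mono[of x y] by (cases "x = y") auto

lemma Phi_mono_abs: "\<bar>x\<bar> \<le> \<bar>y\<bar> \<Longrightarrow> \<Phi> x \<le> \<Phi> y"
  using Phi_mono[of "\<bar>x\<bar>" "\<bar>y\<bar>"] by simp

lemma Phi_nonneg [simp]: "0 \<le> \<Phi> x"
  using Phi_mono_abs[of 0 x] by simp

lemma Phi_pos_iff [simp]: "0 < \<Phi> x \<longleftrightarrow> x \<noteq> 0"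
  using Phi_strict_mono[of 0 "\<bar>x\<bar>"] by (cases "x = 0") auto

lemma Phi_scale_le:
  assumes "1 \<le> c"
  shows "\<Phi> (c * x) \<le> c * \<Phi> x"
proof (cases "x = 0")
  case False
  have "\<bar>x\<bar> \<le> c * \<bar>x\<bar>"
    using mult_right_mono[OF assms, of "\<bar>x\<bar>"] by simp
  then have "\<bar>x\<bar> * \<Phi> \<bar>c * x\<bar> \<le> \<bar>x\<bar> * (c * \<Phi> \<bar>x\<bar>)"
    using Phi_concave[of "\<bar>x\<bar>" "c * \<bar>x\<bar>"] assms by (simp add: abs_mult mult_ac del: Phi_abs)
  then show ?thesis using False by simp
qed simp

text \<open>With s = |x| + |y|, monotonicity of the quotient gives \<Phi>(x) \<ge> (|x|/s) \<Phi>(s)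
  and likewise for y; the two weights add up to 1.\<close>

lemma Phi_add_le: "\<Phi> (x + y) \<le> \<Phi> x + \<Phi> y"
proof (cases "\<bar>x\<bar> + \<bar>y\<bar> = 0")
  case False
  define s where "s = \<bar>x\<bar> + \<bar>y\<bar>"
  have s: "s > 0" using False by (simp add: s_def)
  have "\<bar>x\<bar> * \<Phi> s + \<bar>y\<bar> * \<Phi> s \<le> s * \<Phi> x + s * \<Phi> y"
    using Phi_concave[of "\<bar>x\<bar>" s] Phi_concave[of "\<bar>y\<bar>" s] by (auto simp: s_def)
  then have "s * \<Phi> s \<le> s * (\<Phi> x + \<Phi> y)"
    by (simp add: s_def algebra_simps)
  then have "\<Phi> s \<le> \<Phi> x + \<Phi> y" using s by simp
  moreover have "\<Phi> (x + y) \<le> \<Phi> s"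
    by (rule Phi_mono_abs) (auto simp: s_def)
  ultimately show ?thesis by linarith
qed (simp add: add_nonneg_eq_0_iff)

lemma Phi_k_mult [simp]: "\<Phi> (k * x) = 2 * \<Phi> x"
proof (cases "x = 0")
  case False
  then show ?thesis
    using Phi_doubling[of "\<bar>x\<bar>"] Phi_abs[of "k * x"] k_ge_2 by (simp add: abs_mult)
qed simp

lemma Phi_k_power_mult [simp]: "\<Phi> (k ^ n * x) = 2 ^ n * \<Phi> x"
  by (induction n) (auto simp: mult.assoc)

lemma Phi_k_power_divide: "\<Phi> (x / k ^ n) = \<Phi> x / 2 ^ n"
  using Phi_k_power_mult[of n "x / k ^ n"] k_ge_2 by (simp add: field_simps)

text \<open>For k = 2 the doubling identity gives \<Phi>(2^n) = 2^n \<Phi>(1), so the secant from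
  2^n to 2^(n+1) has slope \<Phi>(1) for every n. For large n this slope would have to be at most
  half of that.\<close>

lemma k_gt_2: "2 < k"
proof (rule ccontr)
  assume "\<not> 2 < k"
  then have "k = 2" using k_ge_2 by simp
  obtain T where T: "\<And>x y. T \<le> x \<Longrightarrow> x < y \<Longrightarrow> \<Phi> y - \<Phi> x \<le> (\<Phi> 1 / 2) * (y - x)"
    using N_star_function_vanishing_slope[OF N, of "\<Phi> 1 / 2"] by auto
  obtain n where "T < 2 ^ n" using real_arch_pow[of 2 T] by auto
  define t :: real where "t = 2 ^ n"
  have "t > 0" "T \<le> t" using \<open>T < 2 ^ n\<close> by (auto simp: t_def)
  have "t * \<Phi> 1 = \<Phi> (k * t) - \<Phi> t"
    unfolding Phi_k_mult using Phi_k_power_mult[of n 1] \<open>k = 2\<close> by (simp add: t_def)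
  also have "\<dots> \<le> (\<Phi> 1 / 2) * t"
    using T[of t "k * t"] \<open>T \<le> t\<close> \<open>t > 0\<close> \<open>k = 2\<close> by simp
  also have "\<dots> < t * \<Phi> 1" using \<open>t > 0\<close> by simp
  finally show False by simp
qed

text \<open>Subadditivity reduces continuity at x to continuity at 0, where \<Phi>(1/k^n) =
  \<Phi>(1)/2^n tends to 0.\<close>

lemma Phi_continuous: "continuous_on UNIV \<Phi>"
proof -
  have "\<exists>d>0. \<forall>y. \<bar>y - x\<bar> < d \<longrightarrow> \<bar>\<Phi> y - \<Phi> x\<bar> < e" if "e > 0" for x e
  proof -
    obtain n where n: "\<Phi> 1 / e < 2 ^ n" using real_arch_pow[of 2] by auto
    have "\<bar>\<Phi> y - \<Phi> x\<bar> < e" if "\<bar>y - x\<bar> < 1 / k ^ n" for y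
    proof -
      have "\<Phi> (y - x) \<le> \<Phi> (1 / k ^ n)"
        using that k_ge_2 by (intro Phi_mono_abs) auto
      also have "\<dots> < e" using n \<open>e > 0\<close> by (simp add: Phi_k_power_divide field_simps)
      finally have "\<Phi> (y - x) < e" .
      moreover have "\<Phi> (x - y) = \<Phi> (y - x)"
        by (metis Phi_abs abs_minus_commute)
      ultimately show ?thesis
        using Phi_add_le[of "y - x" x] Phi_add_le[of "x - y" y] by simp
    qed
    then show ?thesis using k_ge_2 by (intro exI[of _ "1 / k ^ n"]) auto
  qed
  then show ?thesis unfolding continuous_on_iff dist_real_def by blast
qed

lemma Phi_measurable [measurable]: "\<Phi> \<in> borel_measurable borel"
  by (rule borel_measurable_continuous_onI[OF Phi_continuous])

lemma Phi_inj:
  assumes "0 \<le> x" "0 \<le> y" "\<Phi> x = \<Phi> y"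
  shows "x = y"
  using Phi_strict_mono[OF assms(1), of y] Phi_strict_mono[OF assms(2), of x] assms(3) by linarith

lemma Phi_inv_eq:
  assumes "0 \<le> x"
  shows "Phi_inv \<Phi> (\<Phi> x) = x"
  unfolding Phi_inv_def using assms by (intro the_equality) (auto intro: Phi_inj)

text \<open>The description in \<open>Phi_inv\<close> denotes something: doubling makes \<Phi>
  unbounded, so the intermediate value theorem on [0, k^n] yields a preimage, unique by strict
  monotonicity.\<close>

lemma Phi_inv:
  assumes "0 < y"
  shows "\<Phi> (Phi_inv \<Phi> y) = y" "0 < Phi_inv \<Phi> y"
proof -
  obtain n where "y / \<Phi> 1 < 2 ^ n" using real_arch_pow[of 2] by auto
  then have "y < 2 ^ n * \<Phi> 1" by (simp add: pos_divide_less_eq)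
  then have "y \<le> \<Phi> (k ^ n)" using Phi_k_power_mult[of n 1] by simp
  moreover have "continuous_on {0..k ^ n} \<Phi>"
    using Phi_continuous by (rule continuous_on_subset) simp
  ultimately obtain x where x: "0 \<le> x" "\<Phi> x = y"
    using IVT'[of \<Phi> 0 y "k ^ n"] assms k_ge_2 by auto
  with assms have "x \<noteq> 0" by auto
  then show "\<Phi> (Phi_inv \<Phi> y) = y" "0 < Phi_inv \<Phi> y"
    using Phi_inv_eq[OF x(1)] x by auto
qed

end

section \<open>Atoms and atomless sets\<close>

text \<open>Relative to a set, so that it applies to what remains after removing all atoms; the
  measure is a parameter because the notion is later used for measures with a density.\<close>

definition atomless_on :: "'a measure \<Rightarrow> 'a set \<Rightarrow> bool" where
  "atomless_on M E \<longleftrightarrow> E \<in> sets M \<and> (\<forall>B\<subseteq>E. \<not> is_atom M B)"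

lemma atomless_on_subset: "atomless_on M E \<Longrightarrow> F \<in> sets M \<Longrightarrow> F \<subseteq> E \<Longrightarrow> atomless_on M F"
  unfolding atomless_on_def by blast

lemma is_atom_sets: "is_atom M A \<Longrightarrow> A \<in> sets M"
  by (simp add: is_atom_def)

context finite_measure
begin

lemma is_atom_measure_pos: "is_atom M A \<Longrightarrow> 0 < measure M A"
  unfolding is_atom_def by (simp add: emeasure_eq_measure)

lemma atomless_on_split:
  assumes "atomless_on M E" "B \<in> sets M" "B \<subseteq> E" "0 < measure M B"
  obtains C where "C \<in> sets M" "C \<subseteq> B" "0 < measure M C" "measure M C < measure M B"
proof -
  have "\<not> is_atom M B" using assms unfolding atomless_on_def by blast
  then obtain C where C: "C \<in> sets M" "C \<subseteq> B" "emeasure M C < emeasure M B" "emeasure M C \<noteq> 0"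
    using assms unfolding is_atom_def by (auto simp: emeasure_eq_measure)
  then show thesis
    using that[of C] by (simp add: emeasure_eq_measure ennreal_less_iff zero_less_measure_iff)
qed

text \<open>Of two disjoint pieces of positive measure, one has at most half of the total. Iterating
  this n times brings the measure below any bound.\<close>

lemma atomless_on_small_subset:
  assumes "atomless_on M E" "B \<in> sets M" "B \<subseteq> E" "0 < measure M B" "0 < e"
  obtains G where "G \<in> sets M" "G \<subseteq> B" "0 < measure M G" "measure M G \<le> e"
proof -
  have halves: "\<exists>G\<in>sets M. G \<subseteq> B \<and> 0 < measure M G \<and> measure M G \<le> measure M B / 2 ^ n" for n
  proof (induction n)
    case 0
    show ?case using assms by auto
  next
    case (Suc n)
    then obtain G where G: "G \<in> sets M" "G \<subseteq> B" "0 < measure M G" "measure M G \<le> measure M B / 2 ^ n"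
      by blast
    have "G \<subseteq> E" using G assms by blast
    with assms(1) G obtain C where C: "C \<in> sets M" "C \<subseteq> G" "0 < measure M C" "measure M C < measure M G"
      by (elim atomless_on_split)
    have D: "measure M (G - C) = measure M G - measure M C"
      using G C by (intro finite_measure_Diff)
    show ?case
    proof (cases "measure M C \<le> measure M G / 2")
      case True
      have "measure M C \<le> measure M B / 2 ^ Suc n" using True G by simp
      then show ?thesis using C G by blast
    next
      case False
      have "measure M (G - C) \<le> measure M B / 2 ^ Suc n" "0 < measure M (G - C)"
        using False G C D by simp_all
      moreover have "G - C \<in> sets M" "G - C \<subseteq> B" using C G by auto
      ultimately show ?thesis by blast
    qed
  qed
  obtain n where "measure M B / e < 2 ^ n" using real_arch_pow[of 2] by auto
  then have "measure M B / 2 ^ n \<le> e" using assms by (simp add: field_simps)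
  with halves[of n] show thesis by (meson order_trans that)
qed

text \<open>Sierpinski's theorem by greedy exhaustion: each step adds a set at least half as large
  as the supremum of what still fits below t. If the limit set fell short of t, a small set outside
  it would have been a candidate in every step, so the increments could not tend to 0.\<close>

lemma atomless_on_intermediate_value:
  assumes E: "atomless_on M E" and t: "0 \<le> t" "t \<le> measure M E"
  obtains F where "F \<in> sets M" "F \<subseteq> E" "measure M F = t"
proof -
  have E_sets: "E \<in> sets M" using E by (simp add: atomless_on_def)
  define P where "P S \<longleftrightarrow> S \<in> sets M \<and> S \<subseteq> E \<and> measure M S \<le> t" for S
  define R where "R S S' \<longleftrightarrow> S \<subseteq> S' \<and> (\<forall>G\<in>sets M. G \<subseteq> E - S \<longrightarrow> measure M G \<le> t - measure M S \<longrightarrow>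
      measure M G \<le> 2 * (measure M S' - measure M S))" for S S'
  have step: "\<exists>S'. P S' \<and> R S S'" if S: "P S" for S
  proof -
    define X where "X = {measure M G |G. G \<in> sets M \<and> G \<subseteq> E - S \<and> measure M G \<le> t - measure M S}"
    have zero: "0 \<in> X" using S unfolding X_def P_def by (auto intro!: exI[of _ "{}"])
    have bdd: "bdd_above X" unfolding X_def by (rule bdd_aboveI[of _ "t - measure M S"]) auto
    \<comment> \<open>The supremum need not be attained, hence the factor 2; when it is 0, the empty
      set serves.\<close>
    have "\<exists>r\<in>X. Sup X \<le> 2 * r"
    proof (cases "Sup X = 0")
      case False
      have "Sup X / 2 < Sup X" using cSup_upper[OF zero bdd] False by simp
      then obtain r where "r \<in> X" "Sup X / 2 < r" using less_cSupD[of X] zero by blast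
      then show ?thesis by (intro bexI[of _ r]) auto
    qed (use zero in auto)
    then obtain G where G: "G \<in> sets M" "G \<subseteq> E - S" "measure M G \<le> t - measure M S" "Sup X \<le> 2 * measure M G"
      unfolding X_def by blast
    have m: "measure M (S \<union> G) = measure M S + measure M G"
      using S G unfolding P_def by (intro finite_measure_Union) auto
    have "P (S \<union> G)" using S G m unfolding P_def by auto
    moreover have "R S (S \<union> G)"
      unfolding R_def m
    proof (intro conjI ballI impI)
      fix H assume "H \<in> sets M" "H \<subseteq> E - S" "measure M H \<le> t - measure M S"
      then have "measure M H \<le> Sup X" by (intro cSup_upper bdd) (auto simp: X_def)
      with G show "measure M H \<le> 2 * (measure M S + measure M G - measure M S)" by simp
    qed auto
    ultimately show ?thesis by blast
  qed
  have "P {}" using t by (simp add: P_def)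
  then have "\<exists>F. \<forall>n. P (F n) \<and> R (F n) (F (Suc n))"
    using step by (intro dependent_nat_choice) auto
  then obtain F where F: "\<And>n. P (F n)" "\<And>n. R (F n) (F (Suc n))"
    by blast
  define U where "U = (\<Union>n. F n)"
  have "incseq F" using F(2) by (intro incseq_SucI) (auto simp: R_def)
  have U: "U \<in> sets M" "U \<subseteq> E" using F(1) by (auto simp: U_def P_def)
  have lim: "(\<lambda>n. measure M (F n)) \<longlonglongrightarrow> measure M U"
    unfolding U_def using F(1) \<open>incseq F\<close> by (intro finite_Lim_measure_incseq) (auto simp: P_def)
  have F_le: "measure M (F n) \<le> measure M U" for n
    using U by (intro finite_measure_mono) (auto simp: U_def)
  have "measure M U \<le> t"
    using lim F(1) by (intro LIMSEQ_le_const2) (auto simp: P_def)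
  moreover have "\<not> measure M U < t"
  proof
    assume less: "measure M U < t"
    have "measure M (E - U) = measure M E - measure M U"
      using E_sets U by (intro finite_measure_Diff)
    then have "0 < measure M (E - U)" using less t by simp
    with E E_sets U less obtain G where G: "G \<in> sets M" "G \<subseteq> E - U" "0 < measure M G" "measure M G \<le> t - measure M U"
      by (elim atomless_on_small_subset[where B = "E - U" and e = "t - measure M U"]) auto
    \<comment> \<open>The same \<open>G\<close> competes at every stage, since \<open>F n\<close> is
      contained in \<open>U\<close> and leaves at least as much room below t.\<close>
    have "measure M G \<le> 2 * (measure M (F (Suc n)) - measure M (F n))" for n
    proof -
      have "G \<subseteq> E - F n" using G(2) by (auto simp: U_def)
      moreover have "measure M G \<le> t - measure M (F n)" using G(4) F_le[of n] by simp
      ultimately show ?thesis using F(2)[of n] G(1) unfolding R_def by blast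
    qed
    moreover have "(\<lambda>n. 2 * (measure M (F (Suc n)) - measure M (F n))) \<longlonglongrightarrow> 2 * (measure M U - measure M U)"
      by (intro tendsto_intros LIMSEQ_Suc lim)
    ultimately have "measure M G \<le> 0"
      by (intro LIMSEQ_le_const[where X = "\<lambda>n. 2 * (measure M (F (Suc n)) - measure M (F n))"]) auto
    with G show False by simp
  qed
  ultimately show thesis using that[of U] U by linarith
qed

text \<open>Where the density is nonzero, both measures have the same null sets. An atom B of the
  weighted measure is cut down to that region and split there with respect to \<open>M\<close>; both
  parts keep positive weighted mass, against the definition of an atom.\<close>

lemma atomless_on_density:
  assumes E: "atomless_on M E" and w [measurable]: "w \<in> borel_measurable M"
    and fin: "finite_measure (density M w)"
  shows "atomless_on (density M w) E"
  unfolding atomless_on_def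
proof (intro conjI allI impI notI)
  interpret N: finite_measure "density M w" by (rule fin)
  show "E \<in> sets (density M w)" using E by (simp add: atomless_on_def)
  have pos: "measure (density M w) S \<noteq> 0 \<longleftrightarrow> measure M (S \<inter> {x\<in>space M. w x \<noteq> 0}) \<noteq> 0" if [measurable]: "S \<in> sets M" for S
  proof -
    have "measure (density M w) S = 0 \<longleftrightarrow> S \<in> null_sets (density M w)"
      by (simp add: N.emeasure_eq_measure null_sets_def)
    also have "\<dots> \<longleftrightarrow> (AE x in M. x \<in> S \<longrightarrow> w x = 0)"
      using that by (subst null_sets_density_iff) auto
    also have "\<dots> \<longleftrightarrow> (AE x in M. x \<notin> S \<inter> {x\<in>space M. w x \<noteq> 0})"
      by (intro AE_cong) auto
    also have "\<dots> \<longleftrightarrow> S \<inter> {x\<in>space M. w x \<noteq> 0} \<in> null_sets M"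
      by (subst AE_iff_null_sets) auto
    also have "\<dots> \<longleftrightarrow> measure M (S \<inter> {x\<in>space M. w x \<noteq> 0}) = 0"
      by (auto simp: emeasure_eq_measure null_sets_def)
    finally show ?thesis by simp
  qed
  fix B assume "B \<subseteq> E" "is_atom (density M w) B"
  then have B [measurable]: "B \<in> sets M" and B_pos: "measure (density M w) B \<noteq> 0"
    and B_atom: "\<And>C. C \<in> sets M \<Longrightarrow> C \<subseteq> B \<Longrightarrow> measure (density M w) C < measure (density M w) B
      \<Longrightarrow> measure (density M w) C = 0"
    by (auto simp: is_atom_def N.emeasure_eq_measure ennreal_less_iff)
  define B' where "B' = B \<inter> {x\<in>space M. w x \<noteq> 0}"
  have B' [measurable]: "B' \<in> sets M" unfolding B'_def by measurable
  have "0 < measure M B'" using pos[OF B] B_pos by (simp add: B'_def zero_less_measure_iff)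
  with E B' \<open>B \<subseteq> E\<close> obtain C where C: "C \<in> sets M" "C \<subseteq> B'" "0 < measure M C" "measure M C < measure M B'"
    by (elim atomless_on_split[where B = B']) (auto simp: B'_def)
  note [measurable] = C(1)
  have eqs: "C \<inter> {x\<in>space M. w x \<noteq> 0} = C" "(B - C) \<inter> {x\<in>space M. w x \<noteq> 0} = B' - C"
    using C(2) by (auto simp: B'_def)
  have "measure M (B' - C) \<noteq> 0"
    using C finite_measure_Diff[OF B' C(1,2)] by simp
  then have "measure (density M w) (B - C) \<noteq> 0"
    using pos[of "B - C"] eqs by simp
  moreover have "measure (density M w) (B - C) = measure (density M w) B - measure (density M w) C"
    using C by (intro N.finite_measure_Diff) (auto simp: B'_def)
  ultimately have "measure (density M w) C < measure (density M w) B"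
    using N.finite_measure_mono[of C B] C by (simp add: B'_def)
  moreover have "C \<subseteq> B" using C by (auto simp: B'_def)
  ultimately have "measure (density M w) C = 0" using B_atom C by blast
  with pos[OF C(1)] eqs C show False by simp
qed

section \<open>Measurable functions are constant on atoms\<close>

lemma is_atom_AE_cases:
  assumes A: "is_atom M A" and [measurable]: "Measurable.pred M P"
  shows "(AE x in M. x \<in> A \<longrightarrow> P x) \<or> (AE x in M. x \<in> A \<longrightarrow> \<not> P x)"
proof -
  have [measurable]: "A \<in> sets M" using A by (rule is_atom_sets)
  define S where "S = {x\<in>A. P x}"
  have S_eq: "S = A \<inter> {x\<in>space M. P x}"
    using sets.sets_into_space[of A M] by (auto simp: S_def)
  have S [measurable]: "S \<in> sets M" unfolding S_eq by measurable
  show ?thesis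
  proof (cases "measure M S < measure M A")
    case True
    then have "S \<in> null_sets M"
      using A S unfolding is_atom_def by (auto simp: emeasure_eq_measure ennreal_less_iff S_def null_sets_def)
    then have "AE x in M. x \<notin> S" by (rule AE_not_in)
    then show ?thesis by (auto simp: S_def)
  next
    case False
    have "measure M (A - S) = measure M A - measure M S"
      by (intro finite_measure_Diff) (auto simp: S_def)
    then have "A - S \<in> null_sets M"
      using False measure_nonneg[of M "A - S"] by (simp add: null_sets_def emeasure_eq_measure)
    then have "AE x in M. x \<notin> A - S" by (rule AE_not_in)
    then show ?thesis by (auto simp: S_def)
  qed
qed

text \<open>An atom is not a null set. This turns almost-everywhere statements on an atom into a
  concrete point, used both to find the constant value and to prove it unique.\<close>

lemma is_atom_AE_witness:
  assumes A: "is_atom M A" and "AE x in M. x \<in> A \<longrightarrow> P x"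
  obtains x where "x \<in> A" "P x"
proof -
  have "\<not> (AE x in M. x \<notin> A)"
    using A is_atom_measure_pos[OF A] by (subst AE_iff_null_sets[symmetric]) (auto simp: is_atom_sets null_sets_def emeasure_eq_measure)
  moreover have "AE x in M. x \<notin> A" if "\<nexists>x. x \<in> A \<and> P x"
    using assms(2) by eventually_elim (use that in blast)
  ultimately show thesis using that by blast
qed

text \<open>The atom decides every predicate \<open>f x \<le> q\<close> with q rational, and these
  countably many decisions determine a real number. No cut is formed: any point \<open>x0\<close>
  that obeys all decisions supplies the constant \<open>f x0\<close>.\<close>

lemma is_atom_AE_const:
  fixes f :: "'a \<Rightarrow> real"
  assumes A: "is_atom M A" and [measurable]: "f \<in> borel_measurable M"
  shows "\<exists>c. AE x in M. x \<in> A \<longrightarrow> f x = c"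
proof -
  define Q where "Q q \<longleftrightarrow> (AE x in M. x \<in> A \<longrightarrow> f x \<le> real_of_rat q)" for q
  have "AE x in M. x \<in> A \<longrightarrow> (f x \<le> real_of_rat q \<longleftrightarrow> Q q)" for q
  proof (cases "Q q")
    case True
    then show ?thesis unfolding Q_def by (auto elim!: eventually_mono)
  next
    case False
    with is_atom_AE_cases[OF A, of "\<lambda>x. f x \<le> real_of_rat q"] show ?thesis
      unfolding Q_def by (auto elim!: eventually_mono)
  qed
  then have ae: "AE x in M. \<forall>q. x \<in> A \<longrightarrow> (f x \<le> real_of_rat q \<longleftrightarrow> Q q)"
    by (subst AE_all_countable) auto
  then have "AE x in M. x \<in> A \<longrightarrow> (\<forall>q. f x \<le> real_of_rat q \<longleftrightarrow> Q q)"
    by eventually_elim auto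
  from A this obtain x0 where x0: "x0 \<in> A" "\<forall>q. f x0 \<le> real_of_rat q \<longleftrightarrow> Q q"
    by (rule is_atom_AE_witness)
  have eq: "a = b" if "\<And>q. a \<le> real_of_rat q \<longleftrightarrow> b \<le> real_of_rat q" for a b :: real
  proof (rule ccontr)
    assume "a \<noteq> b"
    then consider "a < b" | "b < a" by linarith
    then show False
    proof cases
      case 1
      then obtain q where "a < real_of_rat q" "real_of_rat q < b" using of_rat_dense by blast
      then show False using that[of q] by simp
    next
      case 2
      then obtain q where "b < real_of_rat q" "real_of_rat q < a" using of_rat_dense by blast
      then show False using that[of q] by simp
    qed
  qed
  from ae have "AE x in M. x \<in> A \<longrightarrow> f x = f x0"
  proof eventually_elim
    case (elim x)
    show ?case
    proof
      assume "x \<in> A"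
      with elim x0(2) show "f x = f x0" by (intro eq) blast
    qed
  qed
  then show ?thesis ..
qed

lemma fbar_eqI:
  assumes A: "is_atom M A" and "AE x in M. x \<in> A \<longrightarrow> f x = c"
  shows "fbar M A f = c"
  unfolding fbar_def
proof (rule the_equality)
  fix d assume "AE x in M. x \<in> A \<longrightarrow> f x = d"
  with assms(2) have "AE x in M. x \<in> A \<longrightarrow> f x = c \<and> f x = d"
    by eventually_elim auto
  from A this obtain x where "x \<in> A" "f x = c \<and> f x = d"
    by (rule is_atom_AE_witness)
  then show "d = c" by simp
qed (rule assms)

lemma AE_fbar:
  assumes "is_atom M A" "f \<in> borel_measurable M"
  shows "AE x in M. x \<in> A \<longrightarrow> f x = fbar M A f"
proof -
  obtain c where "AE x in M. x \<in> A \<longrightarrow> f x = c"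
    using is_atom_AE_const[OF assms] by blast
  with fbar_eqI[OF assms(1) this] show ?thesis by simp
qed

end

section \<open>The spaces L Phi and their functionals\<close>

text \<open>Mediates between two scales: bisection produces powers of 2, whereas the modular scales
  exactly only along powers of k.\<close>

lemma ex_power_of_two_le:
  fixes x :: real
  assumes "1 \<le> x"
  obtains m where "2 ^ m \<le> x" "x < 2 ^ Suc m"
proof -
  obtain n where "x < 2 ^ n" using real_arch_pow[of 2 x] by auto
  then obtain m where "\<forall>i\<le>m. \<not> x < 2 ^ i" "x < 2 ^ Suc m"
    using ex_least_nat_less[of "\<lambda>n. x < 2 ^ n" n] assms by auto
  then show thesis using that[of m] by force
qed

lemma has_sum_abs_le:
  fixes g :: "'i \<Rightarrow> real"
  assumes "(g has_sum s) I" "\<And>F. finite F \<Longrightarrow> F \<subseteq> I \<Longrightarrow> (\<Sum>i\<in>F. \<bar>g i\<bar>) \<le> C"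
  shows "\<bar>s\<bar> \<le> C"
proof (rule tendsto_upperbound)
  show "((\<lambda>F. \<bar>sum g F\<bar>) \<longlongrightarrow> \<bar>s\<bar>) (finite_subsets_at_top I)"
    using assms(1) unfolding has_sum_def by (rule tendsto_rabs)
  show "eventually (\<lambda>F. \<bar>sum g F\<bar> \<le> C) (finite_subsets_at_top I)"
    by (intro eventually_finite_subsets_at_top_weakI order_trans[OF sum_abs assms(2)])
qed simp

section \<open>The modular, its associated measure and the quasi-norm\<close>

locale N_star_space = finite_measure M + N_star_doubling \<Phi> k
  for M :: "'a measure" and \<Phi> k
begin

definition modular :: "('a \<Rightarrow> real) \<Rightarrow> ennreal" where
  "modular f = (\<integral>\<^sup>+x. ennreal (\<Phi> (f x)) \<partial>M)"

text \<open>The modular of the restrictions of f, packaged as a measure, so that additivity,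
  continuity from above and the intermediate value property become available.\<close>

definition modular_measure :: "('a \<Rightarrow> real) \<Rightarrow> 'a measure" where
  "modular_measure f = density M (\<lambda>x. ennreal (\<Phi> (f x)))"

lemma L_Phi_iff: "f \<in> L_Phi M \<Phi> \<longleftrightarrow> f \<in> borel_measurable M \<and> modular f < \<infinity>"
  by (simp add: L_Phi_def modular_def)

lemma L_Phi_measurable [measurable_dest]: "f \<in> L_Phi M \<Phi> \<Longrightarrow> f \<in> borel_measurable M"
  by (simp add: L_Phi_iff)

lemma modular_mono: "(\<And>x. \<Phi> (f x) \<le> \<Phi> (g x)) \<Longrightarrow> modular f \<le> modular g"
  unfolding modular_def by (intro nn_integral_mono ennreal_leI)

lemma modular_k_power_mult:
  assumes [measurable]: "f \<in> borel_measurable M"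
  shows "modular (\<lambda>x. k ^ n * f x) = ennreal (2 ^ n) * modular f"
  unfolding modular_def by (simp add: ennreal_mult nn_integral_cmult)

lemma modular_k_power_divide:
  assumes [measurable]: "f \<in> borel_measurable M"
  shows "modular (\<lambda>x. f x / k ^ n) = modular f / ennreal (2 ^ n)"
  unfolding modular_def Phi_k_power_divide
  by (simp add: divide_ennreal[symmetric] nn_integral_divide)

lemma L_Phi_add:
  assumes f: "f \<in> L_Phi M \<Phi>" and g: "g \<in> L_Phi M \<Phi>"
  shows "(\<lambda>x. f x + g x) \<in> L_Phi M \<Phi>"
proof -
  note [measurable] = L_Phi_measurable[OF f] L_Phi_measurable[OF g]
  have "modular (\<lambda>x. f x + g x) \<le> (\<integral>\<^sup>+x. ennreal (\<Phi> (f x)) + ennreal (\<Phi> (g x)) \<partial>M)"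
    unfolding modular_def
    by (intro nn_integral_mono) (simp add: ennreal_plus[symmetric] Phi_add_le del: ennreal_plus)
  also have "\<dots> = modular f + modular g"
    unfolding modular_def by (rule nn_integral_add) auto
  also have "\<dots> < \<infinity>" using f g by (simp add: L_Phi_iff)
  finally show ?thesis by (simp add: L_Phi_iff)
qed

lemma L_Phi_mult:
  assumes f: "f \<in> L_Phi M \<Phi>"
  shows "(\<lambda>x. c * f x) \<in> L_Phi M \<Phi>"
proof -
  note [measurable] = L_Phi_measurable[OF f]
  obtain n where n: "\<bar>c\<bar> < k ^ n" using real_arch_pow[of k "\<bar>c\<bar>"] k_ge_2 by auto
  have "modular (\<lambda>x. c * f x) \<le> modular (\<lambda>x. k ^ n * f x)"
    using n k_ge_2 by (intro modular_mono Phi_mono_abs) (auto simp: abs_mult intro!: mult_right_mono)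
  also have "\<dots> < \<infinity>"
    using f by (simp add: modular_k_power_mult L_Phi_iff ennreal_mult_less_top)
  finally show ?thesis by (simp add: L_Phi_iff)
qed

lemma L_Phi_diff:
  assumes "f \<in> L_Phi M \<Phi>" "g \<in> L_Phi M \<Phi>"
  shows "(\<lambda>x. f x - g x) \<in> L_Phi M \<Phi>"
  using L_Phi_add[OF assms(1) L_Phi_mult[OF assms(2), of "-1"]] by simp

lemma L_Phi_indicator_mult:
  assumes f: "f \<in> L_Phi M \<Phi>" and [measurable]: "S \<in> sets M"
  shows "(\<lambda>x. indicator S x * f x) \<in> L_Phi M \<Phi>"
proof -
  note [measurable] = L_Phi_measurable[OF f]
  have "modular (\<lambda>x. indicator S x * f x) \<le> modular f"
    by (intro modular_mono Phi_mono_abs) (auto simp: indicator_def)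
  with f show ?thesis by (simp add: L_Phi_iff)
qed

lemma modular_indicator_const:
  assumes "S \<in> sets M"
  shows "modular (\<lambda>x. c * indicator S x) = ennreal (\<Phi> c * measure M S)"
proof -
  have "modular (\<lambda>x. c * indicator S x) = (\<integral>\<^sup>+x. ennreal (\<Phi> c) * indicator S x \<partial>M)"
    unfolding modular_def by (intro nn_integral_cong) (auto simp: indicator_def)
  also have "\<dots> = ennreal (\<Phi> c * measure M S)"
    using assms by (simp add: nn_integral_cmult_indicator emeasure_eq_measure ennreal_mult)
  finally show ?thesis .
qed

lemma indicator_in_L_Phi: "S \<in> sets M \<Longrightarrow> indicator S \<in> L_Phi M \<Phi>"
  using modular_indicator_const[of S 1] by (simp add: L_Phi_iff)

lemma modular_indicator_mult:
  assumes f: "f \<in> L_Phi M \<Phi>" and [measurable]: "S \<in> sets M"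
  shows "modular (\<lambda>x. indicator S x * f x) = emeasure (modular_measure f) S"
proof -
  note [measurable] = L_Phi_measurable[OF f]
  have "modular (\<lambda>x. indicator S x * f x) = (\<integral>\<^sup>+x. ennreal (\<Phi> (f x)) * indicator S x \<partial>M)"
    unfolding modular_def by (intro nn_integral_cong) (auto simp: indicator_def)
  then show ?thesis by (simp add: modular_measure_def emeasure_density)
qed

lemma sets_modular_measure [simp]: "sets (modular_measure f) = sets M"
  by (simp add: modular_measure_def)

lemma space_modular_measure [simp]: "space (modular_measure f) = space M"
  by (simp add: modular_measure_def)

lemma emeasure_modular_measure_space:
  assumes "f \<in> L_Phi M \<Phi>"
  shows "emeasure (modular_measure f) (space M) = modular f"
  using assms unfolding modular_measure_def modular_def L_Phi_iff
  by (subst emeasure_density) (auto intro!: nn_integral_cong simp: indicator_def)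

lemma finite_measure_modular_measure:
  assumes "f \<in> L_Phi M \<Phi>"
  shows "finite_measure (modular_measure f)"
  using assms by (intro finite_measureI) (auto simp: emeasure_modular_measure_space L_Phi_iff)

lemma modular_indicator_mult_measure:
  assumes "f \<in> L_Phi M \<Phi>" "S \<in> sets M"
  shows "modular (\<lambda>x. indicator S x * f x) = ennreal (measure (modular_measure f) S)"
proof -
  interpret N: finite_measure "modular_measure f" by (rule finite_measure_modular_measure[OF assms(1)])
  show ?thesis using assms by (simp add: modular_indicator_mult N.emeasure_eq_measure)
qed

text \<open>Shows that the infimum in \<open>Phi_norm\<close> is taken over a nonempty set; division
  by k^n divides the modular by 2^n.\<close>

lemma ex_modular_divide_le_1:
  assumes "f \<in> L_Phi M \<Phi>"
  shows "\<exists>l>0. modular (\<lambda>x. f x / l) \<le> 1"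
proof -
  obtain r where r: "modular f = ennreal r" "0 \<le> r"
    using assms by (cases "modular f") (auto simp: L_Phi_iff)
  obtain n where "r < 2 ^ n" using real_arch_pow[of 2 r] by auto
  then have "modular (\<lambda>x. f x / k ^ n) \<le> 1"
    using assms r by (simp add: modular_k_power_divide L_Phi_iff divide_ennreal)
  then show ?thesis using k_ge_2 by (intro exI[of _ "k ^ n"]) auto
qed

lemma Phi_norm_eq: "Phi_norm M \<Phi> f = Inf {l. 0 < l \<and> modular (\<lambda>x. f x / l) \<le> 1}"
proof -
  have "\<Phi> (\<bar>f x\<bar> / l) = \<Phi> (f x / l)" if "0 < l" for l x
    using Phi_abs[of "f x / l"] that by simp
  then show ?thesis
    unfolding Phi_norm_def modular_def by (intro arg_cong[where f = Inf] Collect_cong conj_cong) auto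
qed

lemma Phi_norm_le:
  assumes "0 < l" "modular (\<lambda>x. f x / l) \<le> 1"
  shows "Phi_norm M \<Phi> f \<le> l"
  unfolding Phi_norm_eq using assms by (intro cInf_lower bdd_belowI[of _ 0]) auto

lemma Phi_norm_lessD:
  assumes "f \<in> L_Phi M \<Phi>" "Phi_norm M \<Phi> f < l"
  shows "modular (\<lambda>x. f x / l) \<le> 1"
proof -
  obtain l' where l': "0 < l'" "modular (\<lambda>x. f x / l') \<le> 1" "l' < l"
    using cInf_lessD[OF _ assms(2)[unfolded Phi_norm_eq]] ex_modular_divide_le_1[OF assms(1)] by auto
  have "modular (\<lambda>x. f x / l) \<le> modular (\<lambda>x. f x / l')"
    using l' by (intro modular_mono Phi_mono_abs) (auto intro!: divide_left_mono)
  with l' show ?thesis by simp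
qed

text \<open>Quasi-norm at most 1 makes only the numbers 1 + e admissible at first. The quotient
  bound \<Phi>(cx) \<le> c \<Phi>(x) then costs a factor 1 + e, which disappears as e tends to
  0.\<close>

lemma modular_le_1:
  assumes f: "f \<in> L_Phi M \<Phi>" and "Phi_norm M \<Phi> f \<le> 1"
  shows "modular f \<le> 1"
proof (rule ennreal_le_epsilon)
  note [measurable] = L_Phi_measurable[OF f]
  fix e :: real assume "0 < e"
  have "modular f \<le> (\<integral>\<^sup>+x. ennreal (1 + e) * ennreal (\<Phi> (f x / (1 + e))) \<partial>M)"
    unfolding modular_def
  proof (intro nn_integral_mono)
    fix x
    have "\<Phi> ((1 + e) * (f x / (1 + e))) \<le> (1 + e) * \<Phi> (f x / (1 + e))"
      using \<open>0 < e\<close> by (intro Phi_scale_le) auto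
    then have "\<Phi> (f x) \<le> (1 + e) * \<Phi> (f x / (1 + e))"
      using \<open>0 < e\<close> by (simp add: add_pos_pos less_imp_neq[symmetric])
    then show "ennreal (\<Phi> (f x)) \<le> ennreal (1 + e) * ennreal (\<Phi> (f x / (1 + e)))"
      using \<open>0 < e\<close> by (simp add: ennreal_mult[symmetric] del: ennreal_plus)
  qed
  also have "\<dots> = ennreal (1 + e) * modular (\<lambda>x. f x / (1 + e))"
    unfolding modular_def by (intro nn_integral_cmult) auto
  also have "\<dots> \<le> ennreal (1 + e) * 1"
    using \<open>0 < e\<close> assms(2) by (intro mult_left_mono Phi_norm_lessD[OF f]) auto
  also have "\<dots> = 1 + ennreal e" using \<open>0 < e\<close> by (simp add: ennreal_plus)
  finally show "modular f \<le> 1 + ennreal e" .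
qed

section \<open>Continuous linear functionals on the atomless part\<close>

context
  fixes U :: "('a \<Rightarrow> real) \<Rightarrow> real"
  assumes U: "cont_lin_functional M \<Phi> U"
begin

lemma functional_add: "f \<in> L_Phi M \<Phi> \<Longrightarrow> g \<in> L_Phi M \<Phi> \<Longrightarrow> U (\<lambda>x. f x + g x) = U f + U g"
  using U unfolding cont_lin_functional_def by blast

lemma functional_mult: "f \<in> L_Phi M \<Phi> \<Longrightarrow> U (\<lambda>x. c * f x) = c * U f"
  using U unfolding cont_lin_functional_def by blast

lemma functional_cong_AE:
  "f \<in> L_Phi M \<Phi> \<Longrightarrow> g \<in> L_Phi M \<Phi> \<Longrightarrow> AE x in M. f x = g x \<Longrightarrow> U f = U g"
  using U unfolding cont_lin_functional_def by blast

lemma functional_indicator_Un: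
  assumes "f \<in> L_Phi M \<Phi>" "S \<in> sets M" "T \<in> sets M" "S \<inter> T = {}"
  shows "U (\<lambda>x. indicator (S \<union> T) x * f x) = U (\<lambda>x. indicator S x * f x) + U (\<lambda>x. indicator T x * f x)"
proof -
  have "(\<lambda>x. indicator (S \<union> T) x * f x) = (\<lambda>x. indicator S x * f x + indicator T x * f x)"
    using assms(4) by (auto simp: indicator_def fun_eq_iff)
  then show ?thesis using assms by (simp add: functional_add L_Phi_indicator_mult)
qed

text \<open>A modular of at most 2^-n is raised to at most 1 by the factor k^n, so the quasi-norm is
  at most k^-n.\<close>

lemma functional_small:
  assumes "0 < e"
  shows "\<exists>d>0. \<forall>g\<in>L_Phi M \<Phi>. modular g \<le> ennreal d \<longrightarrow> \<bar>U g\<bar> < e"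
proof -
  have zero: "(\<lambda>x. 0) \<in> L_Phi M \<Phi>" by (simp add: L_Phi_iff modular_def)
  have U0: "U (\<lambda>x. 0) = 0" using functional_mult[OF zero, of 0] by simp
  from U zero assms obtain d where "0 < d" and
    d: "\<And>g. g \<in> L_Phi M \<Phi> \<Longrightarrow> Phi_norm M \<Phi> (\<lambda>x. g x - 0) < d \<Longrightarrow> \<bar>U g - U (\<lambda>x. 0)\<bar> < e"
    unfolding cont_lin_functional_def by meson
  obtain n where "1 / d < k ^ n" using real_arch_pow[of k "1 / d"] k_ge_2 by auto
  then have n: "1 / k ^ n < d" using \<open>0 < d\<close> k_ge_2 by (simp add: field_simps)
  have "\<bar>U g\<bar> < e" if g: "g \<in> L_Phi M \<Phi>" and small: "modular g \<le> ennreal (1 / 2 ^ n)" for g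
  proof -
    note [measurable] = L_Phi_measurable[OF g]
    have "modular (\<lambda>x. g x / (1 / k ^ n)) = ennreal (2 ^ n) * modular g"
      using modular_k_power_mult[of g n] by (simp add: mult.commute)
    also have "\<dots> \<le> ennreal (2 ^ n) * ennreal (1 / 2 ^ n)"
      using small by (intro mult_left_mono) auto
    also have "\<dots> = 1" by (simp add: ennreal_mult[symmetric])
    finally have "Phi_norm M \<Phi> g \<le> 1 / k ^ n"
      using k_ge_2 by (intro Phi_norm_le) auto
    then show ?thesis using d[OF g] n U0 by simp
  qed
  then show ?thesis by (intro exI[of _ "1 / 2 ^ n"]) auto
qed

lemma functional_atomless_halving:
  assumes f: "f \<in> L_Phi M \<Phi>" and E: "atomless_on M E"
  shows "\<exists>S\<in>sets M. S \<subseteq> E \<and> measure (modular_measure f) S \<le> measure (modular_measure f) E / 2 ^ m \<and>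
    \<bar>U (\<lambda>x. indicator E x * f x)\<bar> \<le> 2 ^ m * \<bar>U (\<lambda>x. indicator S x * f x)\<bar>"
proof (induction m)
  case 0
  show ?case using E by (auto simp: atomless_on_def)
next
  case (Suc m)
  note [measurable] = L_Phi_measurable[OF f]
  interpret N: finite_measure "modular_measure f" by (rule finite_measure_modular_measure[OF f])
  from Suc obtain S where S: "S \<in> sets M" "S \<subseteq> E"
    "measure (modular_measure f) S \<le> measure (modular_measure f) E / 2 ^ m"
    "\<bar>U (\<lambda>x. indicator E x * f x)\<bar> \<le> 2 ^ m * \<bar>U (\<lambda>x. indicator S x * f x)\<bar>"
    by blast
  have "atomless_on M S" by (rule atomless_on_subset[OF E S(1,2)])
  then have "atomless_on (modular_measure f) S"
    unfolding modular_measure_def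
    using finite_measure_modular_measure[OF f, unfolded modular_measure_def]
    by (intro atomless_on_density) auto
  then obtain F where F: "F \<in> sets M" "F \<subseteq> S"
    "measure (modular_measure f) F = measure (modular_measure f) S / 2"
    by (rule N.atomless_on_intermediate_value[of S "measure (modular_measure f) S / 2"]) auto
  have Diff: "measure (modular_measure f) (S - F) = measure (modular_measure f) S / 2"
    using N.finite_measure_Diff[of S F] F S by simp
  have "U (\<lambda>x. indicator S x * f x) = U (\<lambda>x. indicator F x * f x) + U (\<lambda>x. indicator (S - F) x * f x)"
    using functional_indicator_Un[OF f F(1), of "S - F"] F S by (simp add: Un_absorb1)
  then have "\<bar>U (\<lambda>x. indicator S x * f x)\<bar> \<le> 2 * \<bar>U (\<lambda>x. indicator F x * f x)\<bar> \<or>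
      \<bar>U (\<lambda>x. indicator S x * f x)\<bar> \<le> 2 * \<bar>U (\<lambda>x. indicator (S - F) x * f x)\<bar>"
    by linarith
  \<comment> \<open>Both halves carry the same mass of \<open>modular_measure f\<close>, so the
    choice can be made by the value of U alone.\<close>
  then obtain T where T: "T \<in> {F, S - F}"
    and UT: "\<bar>U (\<lambda>x. indicator S x * f x)\<bar> \<le> 2 * \<bar>U (\<lambda>x. indicator T x * f x)\<bar>"
    by blast
  show ?case
  proof (intro bexI[of _ T] conjI)
    show "T \<in> sets M" "T \<subseteq> E" using T F S by auto
    show "measure (modular_measure f) T \<le> measure (modular_measure f) E / 2 ^ Suc m"
      using T F Diff S by auto
    note S(4)
    also have "2 ^ m * \<bar>U (\<lambda>x. indicator S x * f x)\<bar> \<le> 2 ^ m * (2 * \<bar>U (\<lambda>x. indicator T x * f x)\<bar>)"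
      by (intro mult_left_mono UT) auto
    finally show "\<bar>U (\<lambda>x. indicator E x * f x)\<bar> \<le> 2 ^ Suc m * \<bar>U (\<lambda>x. indicator T x * f x)\<bar>"
      by (simp add: mult_ac)
  qed
qed

lemma functional_atomless_eq_0:
  assumes f: "f \<in> L_Phi M \<Phi>" and E: "atomless_on M E"
  shows "U (\<lambda>x. indicator E x * f x) = 0"
proof (rule ccontr)
  note [measurable] = L_Phi_measurable[OF f]
  define r where "r = measure (modular_measure f)"
  assume "U (\<lambda>x. indicator E x * f x) \<noteq> 0"
  then have "0 < \<bar>U (\<lambda>x. indicator E x * f x)\<bar>" by simp
  \<comment> \<open>The tolerance is the supposedly nonzero value itself, so a rescaled piece of
    modular at most d contradicts the lower bound kept through the halvings.\<close>
  then obtain d where "0 < d" and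
    d: "\<And>g. g \<in> L_Phi M \<Phi> \<Longrightarrow> modular g \<le> ennreal d \<Longrightarrow> \<bar>U g\<bar> < \<bar>U (\<lambda>x. indicator E x * f x)\<bar>"
    using functional_small by meson
  have r: "0 \<le> r S" for S by (simp add: r_def)
  \<comment> \<open>The estimate below ends with (2/k)^j times 2 \<open>r E\<close>; adding 1 keeps
    the divisor positive when \<open>r E\<close> is 0.\<close>
  obtain j where j: "(2 / k) ^ j < d / (2 * r E + 1)"
    using real_arch_pow_inv[of "d / (2 * r E + 1)" "2 / k"] k_gt_2 \<open>0 < d\<close> r[of E]
    by (auto simp: add_nonneg_pos)
  obtain m where m: "2 ^ m \<le> k ^ j" "k ^ j < 2 ^ Suc m"
    using ex_power_of_two_le[of "k ^ j"] k_ge_2 by (auto simp: one_le_power)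
  obtain S where S: "S \<in> sets M" "r S \<le> r E / 2 ^ m"
    "\<bar>U (\<lambda>x. indicator E x * f x)\<bar> \<le> 2 ^ m * \<bar>U (\<lambda>x. indicator S x * f x)\<bar>"
    using functional_atomless_halving[OF f E, of m] unfolding r_def by blast
  have fS: "(\<lambda>x. indicator S x * f x) \<in> L_Phi M \<Phi>" by (rule L_Phi_indicator_mult[OF f S(1)])
  note [measurable] = L_Phi_measurable[OF fS]
  have "modular (\<lambda>x. 2 ^ m * (indicator S x * f x)) \<le> modular (\<lambda>x. k ^ j * (indicator S x * f x))"
    using m(1) k_ge_2 by (intro modular_mono Phi_mono_abs) (auto simp: abs_mult intro!: mult_right_mono)
  also have "\<dots> = ennreal (2 ^ j * r S)"
    using modular_indicator_mult_measure[OF f S(1)]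
    by (simp add: modular_k_power_mult r_def ennreal_mult)
  also have "\<dots> \<le> ennreal d"
  proof (rule ennreal_leI)
    have "2 ^ j * r S \<le> 2 ^ j * (r E / 2 ^ m)"
      by (intro mult_left_mono S) auto
    \<comment> \<open>The power 2^m exceeds only half of k^j, which is the origin of the factor
      2.\<close>
    also have "\<dots> \<le> 2 ^ j * (r E * (2 / k ^ j))"
      using m(2) k_ge_2 r[of E] by (intro mult_left_mono) (auto simp: field_simps intro!: mult_left_mono)
    also have "\<dots> = (2 / k) ^ j * (2 * r E)" by (simp add: power_divide)
    also have "\<dots> \<le> (2 / k) ^ j * (2 * r E + 1)"
      using k_ge_2 by (intro mult_left_mono) auto
    also have "\<dots> \<le> d" using j r[of E] by (simp add: field_simps)
    finally show "2 ^ j * r S \<le> d" .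
  qed
  finally have "\<bar>U (\<lambda>x. 2 ^ m * (indicator S x * f x))\<bar> < \<bar>U (\<lambda>x. indicator E x * f x)\<bar>"
    by (intro d L_Phi_mult fS)
  then show False using S(3) functional_mult[OF fS, of "2 ^ m"] by (simp add: abs_mult)
qed

end

section \<open>Families of atoms and the coordinates of a function\<close>

context
  fixes I :: "nat set" and A :: "nat \<Rightarrow> 'a set"
  assumes family: "atom_family M I A"
begin

lemma family_atom: "i \<in> I \<Longrightarrow> is_atom M (A i)"
  using family by (simp add: atom_family_def)

lemma family_sets: "i \<in> I \<Longrightarrow> A i \<in> sets M"
  by (intro is_atom_sets family_atom)

lemma family_disjoint: "disjoint_family_on A I"
  using family by (simp add: atom_family_def)

lemma family_UN_sets: "J \<subseteq> I \<Longrightarrow> (\<Union>i\<in>J. A i) \<in> sets M"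
  using family_sets by (intro sets.countable_UN') auto

text \<open>An atom in the complement would differ from some \<open>A i\<close> by a null set while
  being disjoint from it, and would then be null itself.\<close>

lemma atomless_on_family_complement: "atomless_on M (space M - (\<Union>i\<in>I. A i))"
  unfolding atomless_on_def
proof (intro conjI allI impI notI)
  show "space M - (\<Union>i\<in>I. A i) \<in> sets M"
    using family_UN_sets by auto
  fix B assume B: "B \<subseteq> space M - (\<Union>i\<in>I. A i)" "is_atom M B"
  then obtain i where i: "i \<in> I" "emeasure M ((B - A i) \<union> (A i - B)) = 0"
    using family unfolding atom_family_def by blast
  have "B \<in> sets M" "A i \<in> sets M" using B i is_atom_sets family_sets by auto
  moreover have "B \<subseteq> (B - A i) \<union> (A i - B)" using B i by auto
  ultimately have "emeasure M B \<le> emeasure M ((B - A i) \<union> (A i - B))"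
    by (intro emeasure_mono) auto
  with B i show False by (simp add: is_atom_def)
qed

lemma fbar_mult:
  assumes "i \<in> I" "f \<in> borel_measurable M"
  shows "fbar M (A i) (\<lambda>x. c * f x) = c * fbar M (A i) f"
proof (rule fbar_eqI[OF family_atom[OF assms(1)]])
  show "AE x in M. x \<in> A i \<longrightarrow> c * f x = c * fbar M (A i) f"
    using AE_fbar[OF family_atom[OF assms(1)] assms(2)] by eventually_elim auto
qed

lemma fbar_add:
  assumes "i \<in> I" "f \<in> borel_measurable M" "g \<in> borel_measurable M"
  shows "fbar M (A i) (\<lambda>x. f x + g x) = fbar M (A i) f + fbar M (A i) g"
proof (rule fbar_eqI[OF family_atom[OF assms(1)]])
  show "AE x in M. x \<in> A i \<longrightarrow> f x + g x = fbar M (A i) f + fbar M (A i) g"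
    using AE_fbar[OF family_atom[OF assms(1)] assms(2)] AE_fbar[OF family_atom[OF assms(1)] assms(3)]
    by eventually_elim auto
qed

lemma fbar_cong_AE:
  assumes "i \<in> I" "g \<in> borel_measurable M" "AE x in M. f x = g x"
  shows "fbar M (A i) f = fbar M (A i) g"
proof (rule fbar_eqI[OF family_atom[OF assms(1)]])
  show "AE x in M. x \<in> A i \<longrightarrow> f x = fbar M (A i) g"
    using AE_fbar[OF family_atom[OF assms(1)] assms(2)] assms(3) by eventually_elim auto
qed

lemma AE_indicator_mult_fbar:
  assumes "i \<in> I" "f \<in> borel_measurable M"
  shows "AE x in M. indicator (A i) x * f x = fbar M (A i) f * indicator (A i) x"
  using AE_fbar[OF family_atom[OF assms(1)] assms(2)]
  by eventually_elim (auto simp: indicator_def)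

text \<open>Each summand is the mass that \<open>modular_measure f\<close> gives to
  \<open>A i\<close>, and the atoms are disjoint.\<close>

lemma sum_Phi_fbar_le:
  assumes f: "f \<in> L_Phi M \<Phi>" and F: "finite F" "F \<subseteq> I"
  shows "ennreal (\<Sum>i\<in>F. measure M (A i) * \<Phi> (fbar M (A i) f)) \<le> modular f"
proof -
  note [measurable] = L_Phi_measurable[OF f]
  interpret N: finite_measure "modular_measure f" by (rule finite_measure_modular_measure[OF f])
  have "measure M (A i) * \<Phi> (fbar M (A i) f) = measure (modular_measure f) (A i)" if "i \<in> F" for i
  proof -
    have i: "i \<in> I" using that F by auto
    have "modular (\<lambda>x. indicator (A i) x * f x) = modular (\<lambda>x. fbar M (A i) f * indicator (A i) x)"
      unfolding modular_def using AE_indicator_mult_fbar[OF i L_Phi_measurable[OF f]]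
      by (intro nn_integral_cong_AE, elim eventually_mono) (simp only:)
    then have "ennreal (measure (modular_measure f) (A i)) = ennreal (\<Phi> (fbar M (A i) f) * measure M (A i))"
      unfolding modular_indicator_mult_measure[OF f family_sets[OF i]] modular_indicator_const[OF family_sets[OF i]] .
    then show ?thesis by (simp add: mult.commute)
  qed
  then have "(\<Sum>i\<in>F. measure M (A i) * \<Phi> (fbar M (A i) f)) = (\<Sum>i\<in>F. measure (modular_measure f) (A i))"
    by simp
  also have "\<dots> = measure (modular_measure f) (\<Union>i\<in>F. A i)"
    using F family_sets disjoint_family_on_mono[OF F(2) family_disjoint]
    by (intro N.finite_measure_finite_Union[symmetric]) auto
  also have "ennreal \<dots> \<le> emeasure (modular_measure f) (space M)"
    using N.bounded_measure[of "\<Union>i\<in>F. A i"] by (simp add: N.emeasure_eq_measure)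
  finally show ?thesis by (simp add: emeasure_modular_measure_space[OF f])
qed

lemma Phi_inv_atom:
  assumes "i \<in> I"
  shows "\<Phi> (Phi_inv \<Phi> (1 / measure M (A i))) = 1 / measure M (A i)" "0 < Phi_inv \<Phi> (1 / measure M (A i))"
  using Phi_inv[of "1 / measure M (A i)"] is_atom_measure_pos[OF family_atom[OF assms]] by auto

text \<open>The number w = \<Phi>^{-1}(1/a) is the height at which a multiple of the indicator of
  the atom has modular 1. The bound on the modular forces |f_i| \<le> w, and only then does the
  monotone quotient \<Phi>(x)/x compare the two heights in the right direction.\<close>

lemma abs_fbar_le:
  assumes i: "i \<in> I" and f: "f \<in> L_Phi M \<Phi>" "modular f \<le> 1"
  shows "\<bar>fbar M (A i) f\<bar> \<le> Phi_inv \<Phi> (1 / measure M (A i)) * (measure M (A i) * \<Phi> (fbar M (A i) f))"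
proof -
  define a where "a = measure M (A i)"
  define w where "w = Phi_inv \<Phi> (1 / a)"
  define y where "y = \<bar>fbar M (A i) f\<bar>"
  have a: "0 < a" unfolding a_def by (rule is_atom_measure_pos[OF family_atom[OF i]])
  have w: "\<Phi> w = 1 / a" "0 < w"
    using Phi_inv_atom[OF i] by (auto simp: w_def a_def)
  have "ennreal (a * \<Phi> y) \<le> 1"
    using order_trans[OF sum_Phi_fbar_le[OF f(1), of "{i}"] f(2)] i by (simp add: a_def y_def)
  then have "a * \<Phi> y \<le> 1" by simp
  then have "\<Phi> y \<le> \<Phi> w" unfolding w(1) using a by (simp add: pos_le_divide_eq mult.commute)
  then have "y \<le> w" using Phi_strict_mono[of w y] w by linarith
  then have "y * \<Phi> w \<le> w * \<Phi> y" by (intro Phi_concave) (auto simp: y_def)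
  then have "y / a \<le> w * \<Phi> y" unfolding w(1) by simp
  then have "y \<le> w * (a * \<Phi> y)" using a by (simp add: pos_divide_le_eq mult_ac)
  then show ?thesis by (simp add: y_def w_def a_def)
qed

text \<open>Serves both the upper bound for the norm of a functional and the converse. It is phrased
  for any admissible scale l instead of the quasi-norm, so no attainment of the infimum is involved;
  dividing f by l reduces to modular at most 1.\<close>

lemma sum_abs_fbar_le:
  assumes f: "f \<in> L_Phi M \<Phi>" "0 < l" "modular (\<lambda>x. f x / l) \<le> 1"
    and v: "\<And>i. i \<in> I \<Longrightarrow> \<bar>v i\<bar> * Phi_inv \<Phi> (1 / measure M (A i)) \<le> C" "0 \<le> C"
    and F: "finite F" "F \<subseteq> I"
  shows "(\<Sum>i\<in>F. \<bar>v i * fbar M (A i) f\<bar>) \<le> C * l"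
proof -
  note [measurable] = L_Phi_measurable[OF f(1)]
  define g where "g = (\<lambda>x. (1 / l) * f x)"
  have g: "g \<in> L_Phi M \<Phi>" "modular g \<le> 1"
    using L_Phi_mult[OF f(1), of "1 / l"] f(3) by (auto simp: g_def)
  let ?t = "\<lambda>i. measure M (A i) * \<Phi> (fbar M (A i) g)"
  have "\<bar>v i * fbar M (A i) f\<bar> \<le> l * (C * ?t i)" if "i \<in> F" for i
  proof -
    have i: "i \<in> I" using that F by auto
    have "fbar M (A i) g = (1 / l) * fbar M (A i) f"
      unfolding g_def using i by (intro fbar_mult) auto
    then have "\<bar>v i * fbar M (A i) f\<bar> = l * (\<bar>v i\<bar> * \<bar>fbar M (A i) g\<bar>)"
      using f(2) by (simp add: abs_mult)
    also have "\<dots> \<le> l * (\<bar>v i\<bar> * (Phi_inv \<Phi> (1 / measure M (A i)) * ?t i))"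
      using f(2) abs_fbar_le[OF i g] by (intro mult_left_mono) auto
    also have "\<dots> = l * ((\<bar>v i\<bar> * Phi_inv \<Phi> (1 / measure M (A i))) * ?t i)" by simp
    also have "\<dots> \<le> l * (C * ?t i)"
      using f(2) v(1)[OF i] by (intro mult_left_mono mult_right_mono) auto
    finally show ?thesis .
  qed
  then have "(\<Sum>i\<in>F. \<bar>v i * fbar M (A i) f\<bar>) \<le> (\<Sum>i\<in>F. l * (C * ?t i))"
    by (rule sum_mono)
  also have "\<dots> = l * (C * (\<Sum>i\<in>F. ?t i))" by (simp add: sum_distrib_left)
  also have "\<dots> \<le> l * (C * 1)"
  proof -
    have "ennreal (\<Sum>i\<in>F. ?t i) \<le> 1"
      using sum_Phi_fbar_le[OF g(1) F] g(2) by (rule order_trans)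
    then have "(\<Sum>i\<in>F. ?t i) \<le> 1" by simp
    then show ?thesis using f(2) v(2) by (intro mult_left_mono) auto
  qed
  finally show ?thesis by (simp add: mult.commute)
qed

text \<open>Finite unions of atoms are handled by additivity, the rest of the space by the atomless
  case. For the limit, the remainder after any finite set of indices containing all those below n
  lies in the tail \<open>T n\<close>, whose mass under \<open>modular_measure f\<close> tends to 0.
  As every such finite set is covered, the sum is unordered.\<close>

lemma functional_has_sum:
  assumes U: "cont_lin_functional M \<Phi> U" and f: "f \<in> L_Phi M \<Phi>"
  shows "((\<lambda>i. U (indicator (A i)) * fbar M (A i) f) has_sum U f) I"
proof -
  note [measurable] = L_Phi_measurable[OF f]
  interpret N: finite_measure "modular_measure f" by (rule finite_measure_modular_measure[OF f])
  define V where "V S = U (\<lambda>x. indicator S x * f x)" for S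
  have V_Un: "V (S \<union> T) = V S + V T" if "S \<in> sets M" "T \<in> sets M" "S \<inter> T = {}" for S T
    unfolding V_def by (rule functional_indicator_Un[OF U f that])
  have V_atom: "V (A i) = U (indicator (A i)) * fbar M (A i) f" if i: "i \<in> I" for i
  proof -
    have ind: "indicator (A i) \<in> L_Phi M \<Phi>"
      by (rule indicator_in_L_Phi[OF family_sets[OF i]])
    have "V (A i) = U (\<lambda>x. fbar M (A i) f * indicator (A i) x)"
      unfolding V_def
      by (intro functional_cong_AE[OF U] L_Phi_indicator_mult f family_sets i L_Phi_mult ind AE_indicator_mult_fbar) measurable
    then show ?thesis using functional_mult[OF U ind] by simp
  qed
  have V_sum: "V (\<Union>i\<in>F. A i) = (\<Sum>i\<in>F. U (indicator (A i)) * fbar M (A i) f)" if "finite F" "F \<subseteq> I" for F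
    using that
  proof (induction F)
    case empty
    show ?case using functional_mult[OF U f, of 0] by (simp add: V_def)
  next
    case (insert i F)
    have "A i \<inter> (\<Union>j\<in>F. A j) = {}"
      using disjoint_family_onD[OF family_disjoint, of i] insert by blast
    then have "V (A i \<union> (\<Union>j\<in>F. A j)) = V (A i) + V (\<Union>j\<in>F. A j)"
      using insert by (intro V_Un family_sets family_UN_sets) auto
    then show ?case using insert V_atom by simp
  qed
  have V_I: "V (\<Union>i\<in>I. A i) = U f"
  proof -
    define X0 where "X0 = space M - (\<Union>i\<in>I. A i)"
    have UI: "(\<Union>i\<in>I. A i) \<in> sets M" by (rule family_UN_sets) simp
    have "(\<Union>i\<in>I. A i) \<union> X0 = space M"
      using sets.sets_into_space[OF UI] by (auto simp: X0_def)
    moreover have "V X0 = 0"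
      unfolding V_def X0_def by (rule functional_atomless_eq_0[OF U f atomless_on_family_complement])
    ultimately have "V (space M) = V (\<Union>i\<in>I. A i)"
      using V_Un[OF UI, of X0] UI by (auto simp: X0_def)
    moreover have "V (space M) = U f"
      unfolding V_def by (intro functional_cong_AE[OF U] L_Phi_indicator_mult f) auto
    ultimately show ?thesis by simp
  qed
  define T where "T n = (\<Union>i\<in>I \<inter> {n..}. A i)" for n
  have T_sets: "T n \<in> sets M" for n unfolding T_def by (rule family_UN_sets) simp
  \<comment> \<open>By disjointness a point lies in at most one atom and leaves the tails after its
    index.\<close>
  have "(\<Inter>n. T n) = {}"
  proof -
    have False if x: "\<And>n. x \<in> T n" for x
    proof -
      obtain i where i: "i \<in> I" "x \<in> A i" using x[of 0] by (auto simp: T_def)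
      obtain j where j: "j \<in> I" "Suc i \<le> j" "x \<in> A j" using x[of "Suc i"] by (auto simp: T_def)
      with i disjoint_family_onD[OF family_disjoint, of i j] show False by auto
    qed
    then show ?thesis by auto
  qed
  moreover have "(\<lambda>n. measure (modular_measure f) (T n)) \<longlonglongrightarrow> measure (modular_measure f) (\<Inter>n. T n)"
    using T_sets by (intro N.finite_Lim_measure_decseq) (auto simp: decseq_def T_def)
  ultimately have T_lim: "(\<lambda>n. measure (modular_measure f) (T n)) \<longlonglongrightarrow> 0" by simp
  show ?thesis
    unfolding has_sum_def
  proof (rule tendstoI)
    fix e :: real assume "0 < e"
    then obtain d where d: "0 < d" "\<And>g. g \<in> L_Phi M \<Phi> \<Longrightarrow> modular g \<le> ennreal d \<Longrightarrow> \<bar>U g\<bar> < e"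
      using functional_small[OF U] by meson
    have "eventually (\<lambda>n. measure (modular_measure f) (T n) < d) sequentially"
      by (rule order_tendstoD(2)[OF T_lim d(1)])
    then obtain n where n: "measure (modular_measure f) (T n) < d"
      using eventually_happens'[OF sequentially_bot] by blast
    show "\<forall>\<^sub>F F in finite_subsets_at_top I. dist (\<Sum>i\<in>F. U (indicator (A i)) * fbar M (A i) f) (U f) < e"
      unfolding eventually_finite_subsets_at_top
    proof (intro exI[of _ "I \<inter> {..<n}"] conjI allI impI)
      fix F assume F: "finite F \<and> I \<inter> {..<n} \<subseteq> F \<and> F \<subseteq> I"
      define R where "R = (\<Union>i\<in>I - F. A i)"
      have "I - F \<subseteq> I \<inter> {n..}" using F by (auto simp: not_less[symmetric])
      then have R: "R \<in> sets M" "R \<subseteq> T n"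
        using family_UN_sets[of "I - F"] by (auto simp: R_def T_def)
      have "(\<Union>i\<in>F. A i) \<inter> R = {}"
        using F disjoint_family_onD[OF family_disjoint] unfolding R_def by blast
      then have "V ((\<Union>i\<in>F. A i) \<union> R) = V (\<Union>i\<in>F. A i) + V R"
        using F R by (intro V_Un family_UN_sets) auto
      moreover have "(\<Union>i\<in>F. A i) \<union> R = (\<Union>i\<in>I. A i)" using F by (auto simp: R_def)
      ultimately have eq: "U f = (\<Sum>i\<in>F. U (indicator (A i)) * fbar M (A i) f) + V R"
        using V_I V_sum F by simp
      have "measure (modular_measure f) R \<le> measure (modular_measure f) (T n)"
        using R T_sets by (intro N.finite_measure_mono) auto
      with n have "modular (\<lambda>x. indicator R x * f x) \<le> ennreal d"
        by (simp add: modular_indicator_mult_measure[OF f R(1)] ennreal_leI)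
      then have "\<bar>V R\<bar> < e"
        unfolding V_def by (intro d(2) L_Phi_indicator_mult f R)
      then show "dist (\<Sum>i\<in>F. U (indicator (A i)) * fbar M (A i) f) (U f) < e"
        by (simp add: eq dist_real_def)
    qed auto
  qed
qed

lemma functional_norm_eq:
  assumes U: "cont_lin_functional M \<Phi> U" and "I \<noteq> {}"
  shows "functional_norm M \<Phi> U =
    (SUP i\<in>I. ereal (\<bar>U (indicator (A i))\<bar> * Phi_inv \<Phi> (1 / measure M (A i))))"
    (is "_ = ?S")
proof (rule antisym)
  show "functional_norm M \<Phi> U \<le> ?S"
    unfolding functional_norm_def
  proof (rule SUP_least)
    fix f assume "f \<in> {f \<in> L_Phi M \<Phi>. Phi_norm M \<Phi> f \<le> 1}"
    then have f: "f \<in> L_Phi M \<Phi>" "modular f \<le> 1" using modular_le_1 by auto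
    show "ereal \<bar>U f\<bar> \<le> ?S"
    \<comment> \<open>A supremum of +\<infinity> needs no proof, and -\<infinity> is excluded by a
      member of the nonempty index set, which also gives C \<ge> 0.\<close>
    proof (cases ?S)
      case (real C)
      have le: "\<bar>U (indicator (A i))\<bar> * Phi_inv \<Phi> (1 / measure M (A i)) \<le> C" if "i \<in> I" for i
        using SUP_upper[OF that, of "\<lambda>i. ereal (\<bar>U (indicator (A i))\<bar> * Phi_inv \<Phi> (1 / measure M (A i)))"] real
        by simp
      obtain i where i: "i \<in> I" using \<open>I \<noteq> {}\<close> by blast
      have "0 \<le> \<bar>U (indicator (A i))\<bar> * Phi_inv \<Phi> (1 / measure M (A i))"
        using Phi_inv_atom(2)[OF i] by simp
      also have "\<dots> \<le> C" by (rule le[OF i])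
      finally have "0 \<le> C" .
      have "\<bar>U f\<bar> \<le> C"
      proof (rule has_sum_abs_le[OF functional_has_sum[OF U f(1)]])
        fix F assume "finite F" "F \<subseteq> I"
        then show "(\<Sum>i\<in>F. \<bar>U (indicator (A i)) * fbar M (A i) f\<bar>) \<le> C"
          using sum_abs_fbar_le[OF f(1), of 1 "\<lambda>i. U (indicator (A i))" C F] f(2) le \<open>0 \<le> C\<close> by simp
      qed
      then show ?thesis by (simp add: real)
    next
      case MInf
      obtain i where "i \<in> I" using \<open>I \<noteq> {}\<close> by blast
      then have "ereal (\<bar>U (indicator (A i))\<bar> * Phi_inv \<Phi> (1 / measure M (A i))) \<le> ?S"
        by (rule SUP_upper)
      then show ?thesis by (simp add: MInf)
    qed simp
  qed
  show "?S \<le> functional_norm M \<Phi> U"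
  proof (rule SUP_least)
    fix i assume i: "i \<in> I"
    \<comment> \<open>The multiple of the indicator of \<open>A i\<close> with modular exactly 1 is
      the test function realising the i-th term.\<close>
    define w where "w = Phi_inv \<Phi> (1 / measure M (A i))"
    have w: "\<Phi> w = 1 / measure M (A i)" "0 < w"
      using Phi_inv_atom[OF i] by (auto simp: w_def)
    have ind: "indicator (A i) \<in> L_Phi M \<Phi>"
      by (rule indicator_in_L_Phi[OF family_sets[OF i]])
    have "modular (\<lambda>x. w * indicator (A i) x) = 1"
      using w is_atom_measure_pos[OF family_atom[OF i]]
      by (simp add: modular_indicator_const family_sets[OF i])
    then have "Phi_norm M \<Phi> (\<lambda>x. w * indicator (A i) x) \<le> 1"
      by (intro Phi_norm_le) auto
    then have "ereal \<bar>U (\<lambda>x. w * indicator (A i) x)\<bar> \<le> functional_norm M \<Phi> U"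
      unfolding functional_norm_def using L_Phi_mult[OF ind, of w] by (intro SUP_upper) simp
    then show "ereal (\<bar>U (indicator (A i))\<bar> * Phi_inv \<Phi> (1 / measure M (A i))) \<le> functional_norm M \<Phi> U"
      using functional_mult[OF U ind, of w] w by (simp add: abs_mult w_def mult.commute)
  qed
qed

section \<open>Functionals defined by bounded coefficients\<close>

context
  fixes u :: "nat \<Rightarrow> real" and C :: real
  assumes u_bound: "\<And>i. i \<in> I \<Longrightarrow> \<bar>u i\<bar> * Phi_inv \<Phi> (1 / measure M (A i)) \<le> C"
    and C_nonneg: "0 \<le> C"
begin

lemma fbar_summable:
  assumes f: "f \<in> L_Phi M \<Phi>"
  shows "(\<lambda>i. u i * fbar M (A i) f) summable_on I"
proof -
  obtain l where l: "0 < l" "modular (\<lambda>x. f x / l) \<le> 1"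
    using ex_modular_divide_le_1[OF f] by blast
  have "bdd_above (sum (\<lambda>i. norm (u i * fbar M (A i) f)) ` {F. F \<subseteq> I \<and> finite F})"
    using sum_abs_fbar_le[OF f l u_bound C_nonneg] by (intro bdd_aboveI[of _ "C * l"]) auto
  then have "(\<lambda>i. norm (u i * fbar M (A i) f)) summable_on I"
    by (intro nonneg_bdd_above_summable_on) auto
  then show ?thesis by (rule Infinite_Sum.abs_summable_summable)
qed

text \<open>Additivity of the infinite sum relies on summability on the whole space. The bound |V f|
  \<le> C l for every admissible l, applied to a difference, then gives continuity at each
  point.\<close>

lemma fbar_sum_continuous_linear:
  "cont_lin_functional M \<Phi> (\<lambda>f. \<Sum>\<^sub>\<infinity>i\<in>I. u i * fbar M (A i) f)"
proof -
  define V where "V f = (\<Sum>\<^sub>\<infinity>i\<in>I. u i * fbar M (A i) f)" for f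
  have add: "V (\<lambda>x. f x + g x) = V f + V g" if f: "f \<in> L_Phi M \<Phi>" and g: "g \<in> L_Phi M \<Phi>" for f g
  proof -
    have "V (\<lambda>x. f x + g x) = (\<Sum>\<^sub>\<infinity>i\<in>I. u i * fbar M (A i) f + u i * fbar M (A i) g)"
      unfolding V_def using f g by (intro infsum_cong) (simp add: fbar_add L_Phi_iff distrib_left)
    also have "\<dots> = V f + V g"
      unfolding V_def by (intro infsum_add fbar_summable f g)
    finally show ?thesis .
  qed
  have mult: "V (\<lambda>x. c * f x) = c * V f" if f: "f \<in> L_Phi M \<Phi>" for f c
  proof -
    have "V (\<lambda>x. c * f x) = (\<Sum>\<^sub>\<infinity>i\<in>I. c * (u i * fbar M (A i) f))"
      unfolding V_def using f by (intro infsum_cong) (simp add: fbar_mult L_Phi_iff)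
    then show ?thesis by (simp add: V_def infsum_cmult_right')
  qed
  have cong: "V f = V g" if "g \<in> L_Phi M \<Phi>" "AE x in M. f x = g x" for f g
    unfolding V_def using that fbar_cong_AE[of _ g f] by (intro infsum_cong) (simp add: L_Phi_iff)
  have bound: "\<bar>V f\<bar> \<le> C * l" if f: "f \<in> L_Phi M \<Phi>" "0 < l" "modular (\<lambda>x. f x / l) \<le> 1" for f l
    unfolding V_def
    by (rule has_sum_abs_le[OF has_sum_infsum[OF fbar_summable[OF f(1)]] sum_abs_fbar_le[OF f u_bound C_nonneg]])
  have "\<exists>d>0. \<forall>g\<in>L_Phi M \<Phi>. Phi_norm M \<Phi> (\<lambda>x. g x - f x) < d \<longrightarrow> \<bar>V g - V f\<bar> < e"
    if f: "f \<in> L_Phi M \<Phi>" and "0 < e" for f e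
  \<comment> \<open>Dividing by C + 1 covers C = 0 and makes C times the radius strictly less than
    e.\<close>
  proof (intro exI[of _ "e / (C + 1)"] conjI ballI impI)
    show d: "0 < e / (C + 1)" using \<open>0 < e\<close> C_nonneg by simp
    fix g assume g: "g \<in> L_Phi M \<Phi>" "Phi_norm M \<Phi> (\<lambda>x. g x - f x) < e / (C + 1)"
    have h: "(\<lambda>x. g x - f x) \<in> L_Phi M \<Phi>" by (rule L_Phi_diff[OF g(1) f])
    have "V g - V f = V (\<lambda>x. g x - f x)" using add[OF h f] by simp
    also have "\<bar>\<dots>\<bar> \<le> C * (e / (C + 1))"
      by (rule bound[OF h d Phi_norm_lessD[OF h g(2)]])
    also have "\<dots> < e" using \<open>0 < e\<close> C_nonneg by (simp add: field_simps)
    finally show "\<bar>V g - V f\<bar> < e" .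
  qed
  then have "cont_lin_functional M \<Phi> V"
    unfolding cont_lin_functional_def by (intro conjI ballI allI impI add mult cong)
  then show ?thesis by (simp add: V_def[abs_def])
qed

end

end

end

theorem theorem4p2:
  fixes M :: "'a measure" and \<Phi> :: "real \<Rightarrow> real"
  assumes fin: "emeasure M (space M) < \<infinity>"
    and N: "N_star_function \<Phi>"
    and dbl: "\<exists>k\<ge>2. \<forall>x>0. \<Phi> (k * x) = 2 * \<Phi> x"
  shows
    "({A. is_atom M A} = {} \<longrightarrow>
        (\<forall>U. cont_lin_functional M \<Phi> U \<longrightarrow> (\<forall>f\<in>L_Phi M \<Phi>. U f = 0)))
     \<and>
     (\<forall>(I::nat set) A. {A. is_atom M A} \<noteq> {} \<longrightarrow> atom_family M I A \<longrightarrow>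
        (\<forall>U. cont_lin_functional M \<Phi> U \<longrightarrow>
           (\<forall>f\<in>L_Phi M \<Phi>.
              ((\<lambda>i. U (indicator (A i)) * fbar M (A i) f) has_sum U f) I) \<and>
           functional_norm M \<Phi> U =
             (SUP i\<in>I. ereal (\<bar>U (indicator (A i))\<bar> *
                               Phi_inv \<Phi> (1 / measure M (A i)))))
        \<and>
        (\<forall>(u::nat \<Rightarrow> real) K::real.
           (\<forall>i\<in>I. \<bar>u i\<bar> \<le> K / Phi_inv \<Phi> (1 / measure M (A i))) \<longrightarrow>
           (\<forall>f\<in>L_Phi M \<Phi>. (\<lambda>i. u i * fbar M (A i) f) summable_on I) \<and>
           cont_lin_functional M \<Phi> (\<lambda>f. \<Sum>\<^sub>\<infinity>i\<in>I. u i * fbar M (A i) f)))"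
proof -
  obtain k where k: "2 \<le> k" "\<forall>x>0. \<Phi> (k * x) = 2 * \<Phi> x"
    using dbl by blast
  interpret finite_measure M
    using fin by (intro finite_measureI) simp
  interpret N_star_space M \<Phi> k
    using N k by unfold_locales auto
  show ?thesis
  proof (intro conjI impI allI ballI)
    fix U f assume no_atoms: "{A. is_atom M A} = {}" and U: "cont_lin_functional M \<Phi> U" and f: "f \<in> L_Phi M \<Phi>"
    have "atomless_on M (space M)" using no_atoms by (auto simp: atomless_on_def)
    then have "U (\<lambda>x. indicator (space M) x * f x) = 0"
      by (rule functional_atomless_eq_0[OF U f])
    moreover have "U f = U (\<lambda>x. indicator (space M) x * f x)"
      by (intro functional_cong_AE[OF U f] L_Phi_indicator_mult f) auto
    ultimately show "U f = 0" by simp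
  next
    fix I :: "nat set" and A U f
    assume "atom_family M I A" "cont_lin_functional M \<Phi> U" "f \<in> L_Phi M \<Phi>"
    then show "((\<lambda>i. U (indicator (A i)) * fbar M (A i) f) has_sum U f) I"
      by (rule functional_has_sum)
  next
    fix I :: "nat set" and A U
    assume atoms: "{A. is_atom M A} \<noteq> {}" and family: "atom_family M I A"
      and U: "cont_lin_functional M \<Phi> U"
    \<comment> \<open>Some atom exists, and the family must contain an index for it.\<close>
    have "I \<noteq> {}" using atoms family by (auto simp: atom_family_def)
    then show "functional_norm M \<Phi> U =
        (SUP i\<in>I. ereal (\<bar>U (indicator (A i))\<bar> * Phi_inv \<Phi> (1 / measure M (A i))))"
      by (rule functional_norm_eq[OF family U])
  next
    fix I :: "nat set" and A and u :: "nat \<Rightarrow> real" and K :: real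
    assume family: "atom_family M I A"
      and K: "\<forall>i\<in>I. \<bar>u i\<bar> \<le> K / Phi_inv \<Phi> (1 / measure M (A i))"
    \<comment> \<open>The absolute value of K supplies the nonnegative constant that the lemmas on
      bounded coefficients ask for.\<close>
    have u: "\<bar>u i\<bar> * Phi_inv \<Phi> (1 / measure M (A i)) \<le> \<bar>K\<bar>" if "i \<in> I" for i
    proof -
      have "\<bar>u i\<bar> * Phi_inv \<Phi> (1 / measure M (A i)) \<le> K"
        using K[rule_format, OF that] Phi_inv_atom(2)[OF family that] by (simp add: pos_le_divide_eq)
      then show ?thesis by simp
    qed
    show "(\<lambda>i. u i * fbar M (A i) f) summable_on I" if "f \<in> L_Phi M \<Phi>" for f
      using fbar_summable[OF family u _ that] by simp
    show "cont_lin_functional M \<Phi> (\<lambda>f. \<Sum>\<^sub>\<infinity>i\<in>I. u i * fbar M (A i) f)"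
      using fbar_sum_continuous_linear[OF family u] by simp
  qed
qed

end
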